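(* Let $r>0$. Let $P,Q\in K(x)$ satisfy Condition (M) (stated in the context), let $k$ be the number of zeros of $P'$, $p=\deg P$, $q=\deg Q$. Let $f,g\in\mathcal A_u(d(0,r^-))$ be unbounded analytic functions with $P(f)=Q(g)$, and let $t:=\nu(f)=\nu(g)$ be their (common) ramification index. Then, for all $\rho\in[\rho_0,r[$ (where $0<\rho_0<r$), $$0\;\geq\;\frac{kq-p}{\chi^t q}\,T(\rho,f)+O(1),$$ where $O(1)$ denotes a bounded function of $\rho$; i.e., $qk-p\le0$.
   Context: $K$ is an algebraically closed field of characteristic $\pi$ (possibly $0$), complete with respect to a non-archimedean absolute value $|\cdot|$. $d(0,r^-)=\{x\in K:|x|<r\}$. $\mathcal A(d(0,r^-))$ is the ring of analytic functions on $d(0,r^-)$ (power series with radius of convergence at least $r$), $\mathcal M(d(0,r^-))$ its field of fractions, $\mathcal A_b(d(0,r^-))$ the $K$-subalgebra of bounded analytic functions, and $\mathcal A_u(d(0,r^-))=\mathcal A(d(0,r^-))\setminus\mathcal A_b(d(0,r^-))$. Characteristic exponent and ramification index: $\chi:=\pi$ if $\pi\neq0$, and $\chi:=1$ if $\pi=0$. If $\pi\ne 0$, the ramification index $\nu(h)$ of a non-constant $h\in\mathcal M(d(0,r^-))$ is the unique integer $t\ge0$ such that $\sqrt[\chi^t]{h}\in\mathcal M(d(0,r^-))$ and $(\sqrt[\chi^t]{h})'\neq0$; if $\pi=0$, $\nu(h)=0$. For $f,g$ as in the claim one has $\nu(f)=\nu(g)$. Nevanlinna function: for a function $h$ having neither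 a zero nor a pole at $0$ (a standing assumption for every function to which $T$ is applied), let $w_\alpha(h)=n$ if $h$ has a zero of order $n$ at $\alpha$ and $w_\alpha(h)=-n$ if $h$ has a pole of order $n$ at $\alpha$. Put $Z(\rho,h)=\sum_{w_\alpha(h)>0,\,|\alpha|\le\rho}w_\alpha(h)\log\frac{\rho}{|\alpha|}$, $N(\rho,h)=Z(\rho,1/h)$, $T(\rho,h)=\max\{Z(\rho,h),N(\rho,h)\}$. Degrees: write $P=R/S$, $Q=V/W$ with $R,S,V,W\in K[x]$, $\gcd(R,S)=1$, $\gcd(V,W)=1$; $\deg P=\max\{\deg R,\deg S\}$, $\deg Q=\max\{\deg V,\deg W\}$. Condition (M) on $P,Q\in K(x)$: denote by $c_1,\dots,c_k$ the (distinct) zeros of $P'$ in $K$ (the condition presupposes that the values $P(c_i)\in K$ are defined). Then (1) $P'Q'\neq0$; (2) $P=R/S$ with $\gcd(R,S)=1$, $Q=V/W$ with $V,W$ monic and $\gcd(V,W)=1$, where $R,S,V,W\in K[x]$; (3) $k>0$, and for every $i\in\{1,\dots,k\}$ and every zero $d$ of $V'-P(c_i)W'$ one has $W(d)\neq0$ and $Q(d)\neq P(c_i)$; (4) $P(c_i)\neq P(c_j)$ whenever $i\neq j$; (5) if $\deg V=\deg W$, then $P(c_i)\neq1$ for all $i\in\{1,\dots,k\}$. *)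

theory Defs
  imports
    "HOL-Analysis.Analysis"
    "HOL-Computational_Algebra.Computational_Algebra"
begin

section \<open>Complete non-archimedean fields\<close>

locale complete_nonarch_field =
  fixes absv :: "'a::field \<Rightarrow> real"
  assumes absv_nonneg: "absv x \<ge> 0"
    and absv_eq_0_iff: "absv x = 0 \<longleftrightarrow> x = 0"
    and absv_mult: "absv (x * y) = absv x * absv y"
    and absv_ultrametric: "absv (x + y) \<le> max (absv x) (absv y)"
    and absv_complete: "Metric_space.mcomplete UNIV (\<lambda>x y. absv (x - y))"

definition char_exponent :: "'a::semiring_1 itself \<Rightarrow> nat" where
  "char_exponent _ = (if CHAR('a) = 0 then 1 else CHAR('a))"


section \<open>Rational functions\<close>

text \<open>
  The field \<open>K(x)\<close> is the fraction field of \<open>K[x]\<close>.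
\<close>

definition ratfun_deriv :: "'a::field poly fract \<Rightarrow> 'a poly fract" where
  "ratfun_deriv P =
     (THE D. \<exists>A B. B \<noteq> 0 \<and> P = Fract A B \<and> D = Fract (pderiv A * B - A * pderiv B) (B\<^sup>2))"

lemma ratfun_deriv_Fract:
  fixes A B :: "'a::field poly"
  assumes nz: "B \<noteq> 0"
  shows "ratfun_deriv (Fract A B) = Fract (pderiv A * B - A * pderiv B) (B\<^sup>2)"
proof -
  have "Fract (pderiv C * D - C * pderiv D) (D\<^sup>2) = Fract (pderiv A * B - A * pderiv B) (B\<^sup>2)"
    if D: "D \<noteq> 0" and eq: "Fract A B = Fract C D" for C D
  proof -
    have eq1: "A * D = C * B"
      using eq nz D by (simp add: eq_fract)
    have eq2: "A * pderiv D + D * pderiv A = C * pderiv B + B * pderiv C"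
      using arg_cong[OF eq1, of pderiv] by (simp add: pderiv_mult)
    have "(pderiv A * B - A * pderiv B) * D\<^sup>2 - (pderiv C * D - C * pderiv D) * B\<^sup>2
        = B * D * ((A * pderiv D + D * pderiv A) - (C * pderiv B + B * pderiv C))
          - (A * D - C * B) * (pderiv B * D + B * pderiv D)"
      by (simp add: algebra_simps power2_eq_square)
    also have "\<dots> = 0"
      using eq1 eq2 by simp
    finally show ?thesis
      using nz D by (simp add: eq_fract)
  qed
  then show ?thesis
    unfolding ratfun_deriv_def using nz by (intro the_equality) blast+
qed

text \<open>
  Evaluation of \<open>P \<in> K(x)\<close> at a point \<open>x\<close> of an extension field \<open>\<iota> : K \<rightarrow> L\<close>. It is used with
  \<open>\<iota> = id\<close>, for the value of \<open>P\<close> at a point of \<open>K\<close>, and with \<open>\<iota> = fls_const\<close>, for \<open>P(f)\<close> with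
  \<open>f\<close> a meromorphic function. The value is unspecified at a pole; \<^term>\<open>ratfun_regular\<close>
  says that the value is defined.
\<close>

definition ratfun_regular :: "('a::field \<Rightarrow> 'b::field) \<Rightarrow> 'a poly fract \<Rightarrow> 'b \<Rightarrow> bool" where
  "ratfun_regular \<iota> P x \<longleftrightarrow> (\<exists>A B. P = Fract A B \<and> poly (map_poly \<iota> B) x \<noteq> 0)"

definition ratfun_eval :: "('a::field \<Rightarrow> 'b::field) \<Rightarrow> 'a poly fract \<Rightarrow> 'b \<Rightarrow> 'b" where
  "ratfun_eval \<iota> P x =
     (THE y. \<exists>A B. P = Fract A B \<and> poly (map_poly \<iota> B) x \<noteq> 0 \<and>
                   y = poly (map_poly \<iota> A) x / poly (map_poly \<iota> B) x)"

lemma ratfun_eval_Fract: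
  fixes \<iota> :: "'a::field \<Rightarrow> 'b::field"
  assumes zero: "\<iota> 0 = 0"
    and add: "\<And>a b. \<iota> (a + b) = \<iota> a + \<iota> b"
    and mult: "\<And>a b. \<iota> (a * b) = \<iota> a * \<iota> b"
    and nz: "poly (map_poly \<iota> B) x \<noteq> 0"
  shows "ratfun_eval \<iota> (Fract A B) x = poly (map_poly \<iota> A) x / poly (map_poly \<iota> B) x"
proof -
  have hom_sum: "\<iota> (sum u I) = (\<Sum>i\<in>I. \<iota> (u i))" for u :: "nat \<Rightarrow> 'a" and I
    by (induction I rule: infinite_finite_induct) (simp_all add: zero add)
  have hom_mult: "map_poly \<iota> (C * D) = map_poly \<iota> C * map_poly \<iota> D" for C D
    by (rule poly_eqI) (simp add: coeff_map_poly zero coeff_mult hom_sum mult)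
  have "y = poly (map_poly \<iota> A) x / poly (map_poly \<iota> B) x"
    if eq: "Fract A B = Fract C D" and D: "poly (map_poly \<iota> D) x \<noteq> 0"
      and y: "y = poly (map_poly \<iota> C) x / poly (map_poly \<iota> D) x" for y C D
  proof -
    have "A * D = C * B"
      using eq eq_fract(1)[of B D A C] nz D by (metis map_poly_0 poly_0)
    then have "poly (map_poly \<iota> A) x * poly (map_poly \<iota> D) x
             = poly (map_poly \<iota> C) x * poly (map_poly \<iota> B) x"
      by (metis hom_mult poly_mult)
    then show ?thesis
      using nz D y by (simp add: frac_eq_eq)
  qed
  then show ?thesis
    unfolding ratfun_eval_def using nz by (intro the_equality) blast+
qed

abbreviation ratfun_value :: "'a::field poly fract \<Rightarrow> 'a \<Rightarrow> 'a" where
  "ratfun_value \<equiv> ratfun_eval id"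

definition ratfun_zeros :: "'a::field poly fract \<Rightarrow> 'a set" where
  "ratfun_zeros P = {c. ratfun_regular id P c \<and> ratfun_value P c = 0}"

text \<open>
  The clause \<open>ratfun_regular id P c\<close> is the presupposition that \<open>P(c)\<close> is an element of \<open>K\<close>; it is not
  automatic in positive characteristic \<open>\<pi>\<close>, where \<open>x\<^sup>-\<^sup>\<pi> + x\<^sup>2\<close> has a pole at the zero of
  its derivative.
\<close>

definition condition_M ::
  "'a::field poly fract \<Rightarrow> 'a poly fract \<Rightarrow> 'a poly \<Rightarrow> 'a poly \<Rightarrow> 'a poly \<Rightarrow> 'a poly \<Rightarrow> bool" where
  "condition_M P Q R S V W \<longleftrightarrow>
     (\<forall>c \<in> ratfun_zeros (ratfun_deriv P). ratfun_regular id P c) \<and>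
     (ratfun_deriv P \<noteq> 0 \<and> ratfun_deriv Q \<noteq> 0) \<and>
     (P = Fract R S \<and> S \<noteq> 0 \<and> coprime R S \<and>
      Q = Fract V W \<and> lead_coeff V = 1 \<and> lead_coeff W = 1 \<and> coprime V W) \<and>
     (card (ratfun_zeros (ratfun_deriv P)) > 0 \<and>
      (\<forall>c \<in> ratfun_zeros (ratfun_deriv P).
         \<forall>d. poly (pderiv V - smult (ratfun_value P c) (pderiv W)) d = 0 \<longrightarrow>
             poly W d \<noteq> 0 \<and> ratfun_value Q d \<noteq> ratfun_value P c)) \<and>
     inj_on (ratfun_value P) (ratfun_zeros (ratfun_deriv P)) \<and>
     (degree V = degree W \<longrightarrow>
      (\<forall>c \<in> ratfun_zeros (ratfun_deriv P). ratfun_value P c \<noteq> 1))"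


section \<open>Analytic and meromorphic functions on an open disc\<close>

text \<open>
  An analytic function on \<open>d(0,r\<^sup>-)\<close> is identified with its power series at \<open>0\<close>, and the fraction
  field of the ring of analytic functions is formed inside the field of formal Laurent series.
\<close>

definition analytic_disc :: "('a::field \<Rightarrow> real) \<Rightarrow> real \<Rightarrow> 'a fps set" where
  "analytic_disc absv r = {f. ereal r \<le> conv_radius (\<lambda>n. absv (fps_nth f n))}"

definition fps_value :: "('a::field \<Rightarrow> real) \<Rightarrow> 'a fps \<Rightarrow> 'a \<Rightarrow> 'a" where
  "fps_value absv f x =
     (THE y. (\<lambda>n. absv ((\<Sum>i<n. fps_nth f i * x ^ i) - y)) \<longlonglongrightarrow> 0)"

definition bounded_analytic_disc :: "('a::field \<Rightarrow> real) \<Rightarrow> real \<Rightarrow> 'a fps set" where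
  "bounded_analytic_disc absv r =
     {f \<in> analytic_disc absv r. \<exists>C. \<forall>x. absv x < r \<longrightarrow> absv (fps_value absv f x) \<le> C}"

definition unbounded_analytic_disc :: "('a::field \<Rightarrow> real) \<Rightarrow> real \<Rightarrow> 'a fps set" where
  "unbounded_analytic_disc absv r = analytic_disc absv r - bounded_analytic_disc absv r"

definition meromorphic_disc :: "('a::field \<Rightarrow> real) \<Rightarrow> real \<Rightarrow> 'a fls set" where
  "meromorphic_disc absv r =
     {fps_to_fls a / fps_to_fls b | a b.
        a \<in> analytic_disc absv r \<and> b \<in> analytic_disc absv r \<and> b \<noteq> 0}"

definition ramification_index :: "('a::field \<Rightarrow> real) \<Rightarrow> real \<Rightarrow> 'a fls \<Rightarrow> nat" where
  "ramification_index absv r h =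
     (if CHAR('a) = 0 then 0
      else (THE t. \<exists>u \<in> meromorphic_disc absv r.
                     u ^ (char_exponent TYPE('a) ^ t) = h \<and> fls_deriv u \<noteq> 0))"


section \<open>The Nevanlinna characteristic function\<close>

text \<open>
  The number \<open>w\<^sub>\<alpha>(h)\<close>: positive at a zero, negative at a pole, \<open>0\<close> elsewhere. It is meant for
  \<open>h \<noteq> 0\<close> meromorphic on \<open>d(0,r\<^sup>-)\<close> and \<open>|\<alpha>| < r\<close>. The cofactors \<open>a\<close>, \<open>b\<close> have to be
  analytic on the disc: as a formal series \<open>x - \<alpha>\<close> is invertible for \<open>\<alpha> \<noteq> 0\<close>.
\<close>

definition order_at :: "('a::field \<Rightarrow> real) \<Rightarrow> real \<Rightarrow> 'a fls \<Rightarrow> 'a \<Rightarrow> int" where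
  "order_at absv r h \<alpha> =
     (THE n. \<exists>a \<in> analytic_disc absv r. \<exists>b \<in> analytic_disc absv r.
        fps_value absv a \<alpha> \<noteq> 0 \<and> fps_value absv b \<alpha> \<noteq> 0 \<and>
        h = (fls_X - fls_const \<alpha>) powi n * (fps_to_fls a / fps_to_fls b))"

definition nev_Z :: "('a::field \<Rightarrow> real) \<Rightarrow> real \<Rightarrow> real \<Rightarrow> 'a fls \<Rightarrow> real" where
  "nev_Z absv r \<rho> h =
     (\<Sum>\<alpha> | order_at absv r h \<alpha> > 0 \<and> absv \<alpha> \<le> \<rho>.
        of_int (order_at absv r h \<alpha>) * ln (\<rho> / absv \<alpha>))"

definition nev_N :: "('a::field \<Rightarrow> real) \<Rightarrow> real \<Rightarrow> real \<Rightarrow> 'a fls \<Rightarrow> real" where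
  "nev_N absv r \<rho> h = nev_Z absv r \<rho> (1 / h)"

definition nev_T :: "('a::field \<Rightarrow> real) \<Rightarrow> real \<Rightarrow> real \<Rightarrow> 'a fls \<Rightarrow> real" where
  "nev_T absv r \<rho> h = max (nev_Z absv r \<rho> h) (nev_N absv r \<rho> h)"

end

theory Submission
  imports Defs
begin

text \<open>
  Put \<open>\<lambda>\<^sub>i = P(c\<^sub>i)\<close>. As \<open>c\<^sub>i\<close> is a zero of \<open>P'\<close>, the function \<open>(f - c\<^sub>i)\<^sup>2\<close> divides
  \<open>(R - \<lambda>\<^sub>i S)(f)\<close>. By Bezout, \<open>R(f) W(g) = V(g) S(f)\<close> gives \<open>V(g) = w R(f)\<close> and
  \<open>W(g) = w S(f)\<close> with a unit \<open>w\<close> of the ring of analytic functions, so \<open>(f - c\<^sub>i)\<^sup>2\<close> divides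
  \<open>(V - \<lambda>\<^sub>i W)(g)\<close>. Condition (M) makes the polynomial \<open>V - \<lambda>\<^sub>i W\<close> squarefree, and therefore
  \<open>f - c\<^sub>i\<close> divides \<open>g'\<close>. The factors \<open>f - c\<^sub>i\<close> are pairwise comaximal, so their product divides
  \<open>g'\<close>. If \<open>g' \<noteq> 0\<close>, the multiplicativity of the Gauss norms bounds \<open>|f|\<^sup>k\<close> by a multiple of
  \<open>|g|\<close> as the radius tends to \<open>r\<close>, while the unit \<open>w\<close> has bounded Gauss norm, whence
  \<open>|g|\<^sup>q\<close> is at most a multiple of \<open>|f|\<^sup>p\<close>; as \<open>|f|\<close> is unbounded, \<open>k q \<le> p\<close>. If \<open>g' = 0\<close>, then
  \<open>f' = 0\<close>, and one passes to roots of order \<open>\<pi>\<close> of \<open>f\<close>, \<open>g\<close> and of the coefficients of \<open>P\<close>, \<open>Q\<close>.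
  Given \<open>k q \<le> p\<close>, the estimate holds with error term \<open>0\<close> because \<open>T \<ge> 0\<close>.
\<close>


section \<open>Ring morphisms and polynomials\<close>

text \<open>One notion covers all maps in use: embeddings of constants and of power series,
  evaluation of polynomials at a series, the Frobenius map and its inverse.\<close>

locale domain_morphism =
  fixes h :: "'a::idom \<Rightarrow> 'b::idom"
  assumes hom_one: "h 1 = 1"
    and hom_add: "h (x + y) = h x + h y"
    and hom_mult: "h (x * y) = h x * h y"
begin

lemma hom_zero: "h 0 = 0"
  using hom_add[of 0 0] by (metis add.right_neutral add_left_imp_eq)

lemma hom_uminus: "h (- x) = - h x"
  using hom_add[of x "- x"] by (simp add: hom_zero eq_neg_iff_add_eq_0 add.commute)

lemma hom_diff: "h (x - y) = h x - h y"
  using hom_add[of x "- y"] by (simp add: hom_uminus)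

lemma hom_of_nat: "h (of_nat n) = of_nat n"
  by (induction n) (simp_all add: hom_zero hom_one hom_add)

lemma hom_power: "h (x ^ n) = h x ^ n"
  by (induction n) (simp_all add: hom_one hom_mult)

lemma map_poly_pCons_hom: "map_poly h (pCons a p) = pCons (h a) (map_poly h p)"
  by (simp add: map_poly_pCons hom_zero)

lemma map_poly_add_hom: "map_poly h (p + q) = map_poly h p + map_poly h q"
  by (rule poly_eqI) (simp add: coeff_map_poly hom_zero hom_add)

lemma map_poly_smult_hom: "map_poly h (smult c p) = smult (h c) (map_poly h p)"
  by (rule poly_eqI) (simp add: coeff_map_poly hom_zero hom_mult)

lemma map_poly_mult_hom: "map_poly h (p * q) = map_poly h p * map_poly h q"
  by (induction p)
    (simp_all add: map_poly_pCons_hom map_poly_add_hom map_poly_smult_hom hom_zero)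

lemma domain_morphism_map_poly: "domain_morphism (map_poly h)"
  by standard (simp_all add: hom_one map_poly_add_hom map_poly_mult_hom)

lemma pderiv_map_poly: "pderiv (map_poly h p) = map_poly h (pderiv p)"
  by (rule poly_eqI) (simp add: coeff_map_poly coeff_pderiv hom_zero hom_mult hom_add hom_one hom_of_nat)

lemma poly_map_poly: "poly (map_poly h p) (h x) = h (poly p x)"
  by (induction p) (simp_all add: map_poly_pCons_hom hom_zero hom_add hom_mult)

end

lemma domain_morphism_fps_const: "domain_morphism fps_const"
  by standard simp_all

lemma domain_morphism_fps_to_fls: "domain_morphism (fps_to_fls :: 'a::idom fps \<Rightarrow> _)"
  by standard (simp_all add: fls_times_fps_to_fls)

lemma domain_morphism_frobenius:
  assumes "prime CHAR('a::idom)"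
  shows "domain_morphism (\<lambda>x::'a. x ^ CHAR('a))"
  by standard (simp_all add: assms freshmans_dream power_mult_distrib)

text \<open>Euclid's algorithm: an identity for \<open>b\<close> and \<open>a mod b\<close> turns
  into one for \<open>a\<close> and \<open>b\<close>. Identities serve better than
  \<open>coprime\<close> later on, because every ring morphism preserves them.\<close>

lemma euclidean_ring_bezout:
  fixes a b :: "'a::euclidean_ring"
  assumes "coprime a b"
  shows "\<exists>x y. x * a + y * b = 1"
  using assms
proof (induction "euclidean_size b" arbitrary: a b rule: less_induct)
  case less
  show ?case
  proof (cases "b = 0")
    case True
    then have "a dvd 1"
      using less.prems by simp
    then obtain k where "1 = a * k" ..
    then have "k * a + 0 * b = 1"
      by (simp add: mult.commute)
    then show ?thesis by blast
  next
    case False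
    have "coprime b (a mod b)"
      using less.prems False by (simp add: ac_simps)
    with less.hyps[of "a mod b" b] False
    obtain x y where xy: "x * b + y * (a mod b) = 1"
      using mod_size_less by blast
    have "a mod b = a - a div b * b"
      by (simp add: minus_div_mult_eq_mod)
    with xy have "y * a + (x - y * (a div b)) * b = 1"
      by (simp add: algebra_simps)
    then show ?thesis by blast
  qed
qed

section \<open>Polynomials in a power series\<close>

text \<open>The polynomial is evaluated in the ring of power series instead of being composed with
  \<open>f\<close>, since \<open>f\<close> may have a non-zero constant term.\<close>

definition fps_eval :: "'a::idom poly \<Rightarrow> 'a fps \<Rightarrow> 'a fps" where
  "fps_eval p f = poly (map_poly fps_const p) f"

lemma fps_eval_0 [simp]: "fps_eval 0 f = 0"
  by (simp add: fps_eval_def)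

lemma fps_eval_pCons [simp]: "fps_eval (pCons a p) f = fps_const a + f * fps_eval p f"
  by (simp add: fps_eval_def map_poly_pCons)

lemma domain_morphism_fps_eval: "domain_morphism (\<lambda>p. fps_eval p f)"
  by standard (simp_all add: fps_eval_def
      domain_morphism.map_poly_add_hom[OF domain_morphism_fps_const]
      domain_morphism.map_poly_mult_hom[OF domain_morphism_fps_const])

lemmas fps_eval_1 [simp] = domain_morphism.hom_one[OF domain_morphism_fps_eval]
  and fps_eval_add [simp] = domain_morphism.hom_add[OF domain_morphism_fps_eval]
  and fps_eval_diff [simp] = domain_morphism.hom_diff[OF domain_morphism_fps_eval]
  and fps_eval_mult [simp] = domain_morphism.hom_mult[OF domain_morphism_fps_eval]
  and fps_eval_power [simp] = domain_morphism.hom_power[OF domain_morphism_fps_eval]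

lemma fps_eval_const: "fps_eval [:c:] f = fps_const c"
  by simp

lemma fps_eval_linear: "fps_eval [:- c, 1:] f = f - fps_const c"
  by (simp flip: fps_const_neg)

lemma fps_eval_smult [simp]: "fps_eval (smult c p) f = fps_const c * fps_eval p f"
  by (induction p) (simp_all add: algebra_simps flip: fps_const_mult)

lemma fps_deriv_fps_eval: "fps_deriv (fps_eval p f) = fps_eval (pderiv p) f * fps_deriv f"
  by (induction p) (simp_all add: pderiv_pCons algebra_simps)

text \<open>Brings the evaluation in the field of Laurent series, where \<open>P(f)\<close> is
  defined, back to the ring of power series.\<close>

lemma poly_map_fls_const_fps_to_fls:
  "poly (map_poly fls_const p) (fps_to_fls f) = fps_to_fls (fps_eval p f)"
proof -
  have "map_poly fls_const p = map_poly fps_to_fls (map_poly fps_const p)"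
    by (simp add: map_poly_map_poly o_def)
  then show ?thesis
    by (simp add: fps_eval_def
        domain_morphism.poly_map_poly[OF domain_morphism_fps_to_fls])
qed

text \<open>Write \<open>h = h_0 + X * h_1\<close> and \<open>p\<close> for the characteristic. As
  the Frobenius map is additive, the coefficient of index \<open>n >= p\<close> of
  \<open>h ^ p\<close> is that of index \<open>n - p\<close> of \<open>h_1 ^ p\<close>, and
  induction on \<open>n\<close> applies.\<close>

lemma fps_nth_power_CHAR:
  fixes h :: "'a::idom fps"
  assumes p: "prime CHAR('a)"
  shows "fps_nth (h ^ CHAR('a)) n =
    (if CHAR('a) dvd n then fps_nth h (n div CHAR('a)) ^ CHAR('a) else 0)"
proof (induction n arbitrary: h rule: less_induct)
  case (less n)
  let ?p = "CHAR('a)"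
  have p0: "?p > 0"
    using p by (rule prime_gt_0_nat)
  have "h ^ ?p = (fps_const (fps_nth h 0) + fps_X * fps_shift 1 h) ^ ?p"
    by (rule arg_cong[of _ _ "\<lambda>h. h ^ ?p"]) (simp add: fps_eq_iff)
  also have "\<dots> = fps_const (fps_nth h 0 ^ ?p) + fps_X ^ ?p * fps_shift 1 h ^ ?p"
    using p by (simp add: freshmans_dream power_mult_distrib fps_const_power)
  finally have *: "fps_nth (h ^ ?p) n =
      (if n = 0 then fps_nth h 0 ^ ?p else 0) +
      (if n < ?p then 0 else fps_nth (fps_shift 1 h ^ ?p) (n - ?p))"
    by (simp add: fps_X_power_mult_nth)
  show ?case
  proof (cases "n < ?p")
    case True
    then show ?thesis
      using * p0 by (auto dest: dvd_imp_le)
  next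
    case False
    then have n: "n = (n - ?p) + ?p" "n - ?p < n"
      using p0 by auto
    then have "n div ?p = Suc ((n - ?p) div ?p)" "?p dvd n \<longleftrightarrow> ?p dvd n - ?p"
      using p0 False by (auto simp: le_div_geq dvd_minus_self)
    then show ?thesis
      using * False p0 less.IH[OF n(2), of "fps_shift 1 h"] by auto
  qed
qed

section \<open>Gauss norms\<close>

context complete_nonarch_field
begin

section \<open>Elementary properties of the absolute value\<close>

lemma absv_0 [simp]: "absv 0 = 0"
  by (simp add: absv_eq_0_iff)

lemma absv_1 [simp]: "absv 1 = 1"
  using absv_mult[of 1 1] absv_eq_0_iff[of 1] by simp

lemma absv_power: "absv (x ^ n) = absv x ^ n"
  by (induction n) (simp_all add: absv_mult)

lemma absv_minus [simp]: "absv (- x) = absv x"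
proof -
  have "(absv (- 1))\<^sup>2 = 1"
    by (simp flip: absv_power)
  then have "absv (- 1) = 1"
    using absv_nonneg[of "- 1"] by (simp add: power2_eq_1_iff)
  then show ?thesis
    using absv_mult[of "- 1" x] by simp
qed

lemma absv_of_nat_le_1: "absv (of_nat n) \<le> 1"
proof (induction n)
  case (Suc n)
  then show ?case
    using absv_ultrametric[of 1 "of_nat n"] by simp
qed simp

text \<open>Otherwise \<open>y\<close>, which is \<open>- x + (x + y)\<close>, would be a sum of two
  elements smaller than itself.\<close>

lemma absv_add_eq:
  assumes "absv x < absv y"
  shows "absv (x + y) = absv y"
  using absv_ultrametric[of x y] absv_ultrametric[of "- x" "x + y"] assms by simp

lemma absv_sum_le:
  assumes "\<And>i. i \<in> I \<Longrightarrow> absv (u i) \<le> C" "0 \<le> C"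
  shows "absv (sum u I) \<le> C"
  using assms
proof (induction I rule: infinite_finite_induct)
  case (insert i I)
  then have "absv (u i) \<le> C" "absv (sum u I) \<le> C"
    by auto
  then show ?case
    using insert.hyps absv_ultrametric[of "u i" "sum u I"] by simp
qed simp_all

text \<open>Boundedness of the terms at every radius below \<open>r\<close> amounts to a radius of
  convergence of at least \<open>r\<close>, and passes to sums, products and derivatives by the same
  estimates that bound Gauss norms.\<close>

definition disc_fps :: "real \<Rightarrow> 'a fps set" where
  "disc_fps r = {f. \<forall>\<rho>. 0 < \<rho> \<longrightarrow> \<rho> < r \<longrightarrow> bdd_above (range (\<lambda>n. absv (fps_nth f n) * \<rho> ^ n))}"

text \<open>The non-archimedean counterpart of the maximum modulus at radius \<rho>, meant for
  \<open>f\<close> in \<open>disc_fps r\<close> and 0 < \<rho> < r.\<close>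

definition gauss :: "real \<Rightarrow> 'a fps \<Rightarrow> real" where
  "gauss \<rho> f = (SUP n. absv (fps_nth f n) * \<rho> ^ n)"

lemma analytic_disc_subset_disc_fps: "analytic_disc absv r \<subseteq> disc_fps r"
proof
  fix f
  assume f: "f \<in> analytic_disc absv r"
  show "f \<in> disc_fps r"
    unfolding disc_fps_def
  proof (intro CollectI allI impI)
    fix \<rho> :: real
    assume \<rho>: "0 < \<rho>" "\<rho> < r"
    have "ereal (norm \<rho>) < conv_radius (\<lambda>n. absv (fps_nth f n))"
      using f \<rho> unfolding analytic_disc_def by (auto intro: less_le_trans[of _ "ereal r"])
    then have "summable (\<lambda>n. absv (fps_nth f n) * \<rho> ^ n)"
      by (rule summable_in_conv_radius)
    then have "Bseq (\<lambda>n. absv (fps_nth f n) * \<rho> ^ n)"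
      by (intro convergent_imp_Bseq convergentI[OF summable_LIMSEQ_zero])
    then show "bdd_above (range (\<lambda>n. absv (fps_nth f n) * \<rho> ^ n))"
      by (rule Bseq_bdd_above)
  qed
qed

lemma disc_fpsI:
  assumes "\<And>\<rho>. 0 < \<rho> \<Longrightarrow> \<rho> < r \<Longrightarrow> \<exists>C. \<forall>n. absv (fps_nth f n) * \<rho> ^ n \<le> C"
  shows "f \<in> disc_fps r"
  using assms unfolding disc_fps_def bdd_above_def by auto

lemma gauss_ge:
  assumes "f \<in> disc_fps r" "0 < \<rho>" "\<rho> < r"
  shows "absv (fps_nth f n) * \<rho> ^ n \<le> gauss \<rho> f"
  using assms unfolding disc_fps_def gauss_def by (auto intro: cSUP_upper)

lemma gauss_leI:
  assumes "\<And>n. absv (fps_nth f n) * \<rho> ^ n \<le> C"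
  shows "gauss \<rho> f \<le> C"
  using assms unfolding gauss_def by (intro cSUP_least) auto

lemma gauss_nonneg:
  assumes "f \<in> disc_fps r" "0 < \<rho>" "\<rho> < r"
  shows "0 \<le> gauss \<rho> f"
  using gauss_ge[OF assms, of 0] absv_nonneg[of "fps_nth f 0"] by simp

lemma gauss_pos:
  assumes "f \<in> disc_fps r" "0 < \<rho>" "\<rho> < r" "f \<noteq> 0"
  shows "0 < gauss \<rho> f"
proof -
  obtain n where "fps_nth f n \<noteq> 0"
    using \<open>f \<noteq> 0\<close> by (auto simp: fps_eq_iff)
  then have "0 < absv (fps_nth f n) * \<rho> ^ n"
    using assms absv_nonneg[of "fps_nth f n"] absv_eq_0_iff[of "fps_nth f n"]
    by (intro mult_pos_pos) auto
  then show ?thesis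
    using gauss_ge[OF assms(1-3), of n] by linarith
qed

lemma gauss_const: "gauss \<rho> (fps_const c) = absv c"
proof -
  have "absv (fps_nth (fps_const c) n) * \<rho> ^ n = (if n = 0 then absv c else 0)" for n
    by simp
  then have "range (\<lambda>n. absv (fps_nth (fps_const c) n) * \<rho> ^ n) = {absv c, 0}"
    by (auto simp: image_def intro: exI[of _ 1])
  then show ?thesis
    unfolding gauss_def using absv_nonneg[of c] by (simp add: cSup_eq_Max)
qed

lemma disc_fps_const [simp]: "fps_const c \<in> disc_fps r"
proof (rule disc_fpsI)
  fix \<rho> :: real
  show "\<exists>C. \<forall>n. absv (fps_nth (fps_const c) n) * \<rho> ^ n \<le> C"
    using absv_nonneg[of c] by (intro exI[of _ "absv c"]) simp
qed

lemma disc_fps_1 [simp]: "1 \<in> disc_fps r"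
  using disc_fps_const[of 1] by simp

lemma disc_fps_numeral [simp]: "numeral n \<in> disc_fps r"
  by (simp add: fps_numeral_fps_const)

lemma add_coeff_bound:
  assumes "0 < \<rho>" "absv (fps_nth f n) * \<rho> ^ n \<le> A" "absv (fps_nth g n) * \<rho> ^ n \<le> B"
  shows "absv (fps_nth (f + g) n) * \<rho> ^ n \<le> max A B"
proof -
  have "absv (fps_nth (f + g) n) * \<rho> ^ n \<le> max (absv (fps_nth f n)) (absv (fps_nth g n)) * \<rho> ^ n"
    using assms(1) absv_ultrametric by (intro mult_right_mono) auto
  also have "\<dots> \<le> max A B"
    using assms by (auto simp: max_def)
  finally show ?thesis .
qed

text \<open>A coefficient of the product is at most its largest summand, and the powers of \<rho> in
  each summand multiply to \<open>\<rho> ^ n\<close>. With \<open>A\<close> and \<open>B\<close>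
  arbitrary this gives both closure of \<open>disc_fps r\<close> under products and
  submultiplicativity of \<open>gauss\<close>.\<close>

lemma mult_coeff_bound:
  assumes "0 < \<rho>" "\<And>n. absv (fps_nth f n) * \<rho> ^ n \<le> A" "\<And>n. absv (fps_nth g n) * \<rho> ^ n \<le> B"
  shows "absv (fps_nth (f * g) n) * \<rho> ^ n \<le> A * B"
proof -
  have nonneg: "0 \<le> A" "0 \<le> B"
    using assms(2,3)[of 0] absv_nonneg[of "fps_nth f 0"] absv_nonneg[of "fps_nth g 0"] by auto
  have "absv (fps_nth (f * g) n) \<le> A * B / \<rho> ^ n"
    unfolding fps_mult_nth
  proof (rule absv_sum_le)
    fix i
    assume i: "i \<in> {0..n}"
    have "absv (fps_nth f i * fps_nth g (n - i)) * \<rho> ^ n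
        = (absv (fps_nth f i) * \<rho> ^ i) * (absv (fps_nth g (n - i)) * \<rho> ^ (n - i))"
      using i by (simp add: absv_mult flip: power_add)
    also have "\<dots> \<le> A * B"
      using assms nonneg absv_nonneg by (intro mult_mono) auto
    finally show "absv (fps_nth f i * fps_nth g (n - i)) \<le> A * B / \<rho> ^ n"
      using assms(1) by (simp add: field_simps)
  qed (use nonneg assms(1) in auto)
  then show ?thesis
    using assms(1) by (simp add: field_simps)
qed

lemma disc_fps_add [simp]:
  assumes "f \<in> disc_fps r" "g \<in> disc_fps r"
  shows "f + g \<in> disc_fps r"
  using assms by (intro disc_fpsI) (blast intro: add_coeff_bound gauss_ge)

lemma disc_fps_mult [simp]:
  assumes "f \<in> disc_fps r" "g \<in> disc_fps r"
  shows "f * g \<in> disc_fps r"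
  using assms by (intro disc_fpsI) (blast intro: mult_coeff_bound gauss_ge)

lemma disc_fps_diff [simp]:
  assumes "f \<in> disc_fps r" "g \<in> disc_fps r"
  shows "f - g \<in> disc_fps r"
proof -
  have "f - g = f + fps_const (- 1) * g"
    by (simp flip: fps_const_neg)
  then show ?thesis
    using assms by (metis disc_fps_add disc_fps_mult disc_fps_const)
qed

lemma disc_fps_eval [simp]:
  assumes "f \<in> disc_fps r"
  shows "fps_eval p f \<in> disc_fps r"
  using assms by (induction p) (use disc_fps_const[of 0] in simp_all)

text \<open>The integer factor \<open>n + 1\<close> has absolute value at most 1, so differentiation
  costs only the factor 1 / \<rho> from the shift of indices.\<close>

lemma deriv_coeff_bound:
  assumes "f \<in> disc_fps r" "0 < \<rho>" "\<rho> < r"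
  shows "absv (fps_nth (fps_deriv f) n) * \<rho> ^ n \<le> gauss \<rho> f / \<rho>"
proof -
  have "absv (fps_nth (fps_deriv f) n) \<le> 1 * absv (fps_nth f (Suc n))"
    using absv_of_nat_le_1[of "Suc n"] absv_nonneg unfolding fps_deriv_nth absv_mult Suc_eq_plus1
    by (intro mult_right_mono) auto
  then have "absv (fps_nth (fps_deriv f) n) * \<rho> ^ n * \<rho> \<le> absv (fps_nth f (Suc n)) * \<rho> ^ Suc n"
    using assms by simp
  also have "\<dots> \<le> gauss \<rho> f"
    using assms by (rule gauss_ge)
  finally show ?thesis
    using assms by (simp add: field_simps)
qed

lemma disc_fps_deriv [simp]:
  assumes "f \<in> disc_fps r"
  shows "fps_deriv f \<in> disc_fps r"
  using assms by (intro disc_fpsI) (blast intro: deriv_coeff_bound)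

lemma gauss_deriv_le:
  assumes "f \<in> disc_fps r" "0 < \<rho>" "\<rho> < r"
  shows "gauss \<rho> (fps_deriv f) \<le> gauss \<rho> f / \<rho>"
  using deriv_coeff_bound[OF assms] by (rule gauss_leI)

lemma gauss_add_le:
  assumes "f \<in> disc_fps r" "g \<in> disc_fps r" "0 < \<rho>" "\<rho> < r"
  shows "gauss \<rho> (f + g) \<le> max (gauss \<rho> f) (gauss \<rho> g)"
  using assms by (intro gauss_leI add_coeff_bound gauss_ge) auto

lemma gauss_uminus: "gauss \<rho> (- f) = gauss \<rho> f"
  by (simp add: gauss_def)

lemma gauss_add_eq:
  assumes "f \<in> disc_fps r" "g \<in> disc_fps r" "0 < \<rho>" "\<rho> < r" "gauss \<rho> f < gauss \<rho> g"
  shows "gauss \<rho> (f + g) = gauss \<rho> g"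
proof -
  have "- f \<in> disc_fps r"
    using disc_fps_diff[OF disc_fps_const[of 0] assms(1)] by simp
  then have "gauss \<rho> g \<le> max (gauss \<rho> f) (gauss \<rho> (f + g))"
    using gauss_add_le[of "- f" r "f + g" \<rho>] assms by (simp add: gauss_uminus)
  then show ?thesis
    using gauss_add_le[OF assms(1-4)] assms(5) by simp
qed

text \<open>The coefficients stay bounded at a slightly larger radius, so the terms at \<rho> are
  dominated by a geometric null sequence. From some index on they lie below half the supremum, which
  is thus a maximum over finitely many indices.\<close>

lemma gauss_attained:
  assumes f: "f \<in> disc_fps r" "f \<noteq> 0" and \<rho>: "0 < \<rho>" "\<rho> < r"
  obtains n where "absv (fps_nth f n) * \<rho> ^ n = gauss \<rho> f"
    "\<And>m. m < n \<Longrightarrow> absv (fps_nth f m) * \<rho> ^ m < gauss \<rho> f"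
proof -
  let ?u = "\<lambda>n. absv (fps_nth f n) * \<rho> ^ n"
  define G where "G = gauss \<rho> f"
  have G: "0 < G" "\<And>n. ?u n \<le> G"
    using assms gauss_pos gauss_ge unfolding G_def by blast+
  obtain \<rho>' where \<rho>': "\<rho> < \<rho>'" "\<rho>' < r"
    using \<rho> dense by blast
  have "(\<lambda>n. gauss \<rho>' f * (\<rho> / \<rho>') ^ n) \<longlonglongrightarrow> gauss \<rho>' f * 0"
    using \<rho> \<rho>' by (intro tendsto_mult tendsto_const LIMSEQ_power_zero) simp
  then have "eventually (\<lambda>n. gauss \<rho>' f * (\<rho> / \<rho>') ^ n < G / 2) sequentially"
    using G by (intro order_tendstoD) auto
  then obtain N where N: "\<And>n. n \<ge> N \<Longrightarrow> gauss \<rho>' f * (\<rho> / \<rho>') ^ n < G / 2"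
    unfolding eventually_sequentially by blast
  have tail: "?u n < G / 2" if "n \<ge> N" for n
  proof -
    have "?u n = (absv (fps_nth f n) * \<rho>' ^ n) * (\<rho> / \<rho>') ^ n"
      using \<rho> \<rho>' by (simp add: power_divide)
    also have "\<dots> \<le> gauss \<rho>' f * (\<rho> / \<rho>') ^ n"
      using f \<rho> \<rho>' by (intro mult_right_mono gauss_ge) auto
    finally show ?thesis
      using N[OF that] by linarith
  qed
  have "\<exists>n. ?u n = G"
  proof (rule ccontr)
    assume "\<not> (\<exists>n. ?u n = G)"
    then have less: "?u n < G" for n
      using G(2)[of n] by (metis order_le_less)
    \<comment> \<open>If no term attained the supremum, \<open>M\<close> would be an upper bound of
      all terms strictly below it.\<close>
    define M where "M = Max (insert (G / 2) (?u ` {..<N}))"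
    have "M < G"
      unfolding M_def using less G by (subst Max_less_iff) auto
    have "?u n \<le> M" for n
    proof (cases "n < N")
      case True
      then show ?thesis
        unfolding M_def by (intro Max_ge) auto
    next
      case False
      then have "?u n \<le> G / 2"
        using tail[of n] by simp
      also have "G / 2 \<le> M"
        unfolding M_def by (intro Max_ge) auto
      finally show ?thesis .
    qed
    then have "G \<le> M"
      unfolding G_def by (rule gauss_leI)
    with \<open>M < G\<close> show False by simp
  qed
  then obtain n where "?u n = G" "\<And>m. m < n \<Longrightarrow> ?u m \<noteq> G"
    using exists_least_iff[of "\<lambda>n. ?u n = G"] by blast
  then show ?thesis
    using that[of n] G(2) unfolding G_def by (metis order_le_less)
qed

text \<open>
  With \<open>i\<close>, \<open>j\<close> the first indices at which the Gauss norms are attained, a single summand dominates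
  the coefficient of index \<open>i + j\<close> of the product.
\<close>

lemma gauss_mult:
  assumes f: "f \<in> disc_fps r" and g: "g \<in> disc_fps r" and \<rho>: "0 < \<rho>" "\<rho> < r"
  shows "gauss \<rho> (f * g) = gauss \<rho> f * gauss \<rho> g"
proof (cases "f = 0 \<or> g = 0")
  case True
  then show ?thesis
    using gauss_const[of \<rho> 0] by auto
next
  case False
  then have pos: "0 < gauss \<rho> f" "0 < gauss \<rho> g"
    using assms gauss_pos by blast+
  obtain i where i: "absv (fps_nth f i) * \<rho> ^ i = gauss \<rho> f"
    "\<And>m. m < i \<Longrightarrow> absv (fps_nth f m) * \<rho> ^ m < gauss \<rho> f"
    using gauss_attained[of f r \<rho>] f \<rho> False by blast
  obtain j where j: "absv (fps_nth g j) * \<rho> ^ j = gauss \<rho> g"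
    "\<And>m. m < j \<Longrightarrow> absv (fps_nth g m) * \<rho> ^ m < gauss \<rho> g"
    using gauss_attained[of g r \<rho>] g \<rho> False by blast
  let ?s = "\<lambda>l. fps_nth f l * fps_nth g (i + j - l)"
  have split: "absv (?s l) * \<rho> ^ (i + j)
      = (absv (fps_nth f l) * \<rho> ^ l) * (absv (fps_nth g (i + j - l)) * \<rho> ^ (i + j - l))"
    if "l \<le> i + j" for l
    using that by (simp add: absv_mult flip: power_add)
  have main: "absv (?s i) * \<rho> ^ (i + j) = gauss \<rho> f * gauss \<rho> g"
    using split[of i] i(1) j(1) by simp
  have nn: "0 \<le> absv x * \<rho> ^ n" for x n
    using absv_nonneg \<rho> by simp
  have other: "absv (?s l) * \<rho> ^ (i + j) < gauss \<rho> f * gauss \<rho> g" if l: "l \<le> i + j" "l \<noteq> i" for l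
  proof (cases "l < i")
    case True
    have "absv (?s l) * \<rho> ^ (i + j) \<le> absv (fps_nth f l) * \<rho> ^ l * gauss \<rho> g"
      unfolding split[OF l(1)] by (intro mult_left_mono gauss_ge[OF g \<rho>] nn)
    also have "\<dots> < gauss \<rho> f * gauss \<rho> g"
      by (intro mult_strict_right_mono i(2) True pos)
    finally show ?thesis .
  next
    case False
    with l have "i + j - l < j" by simp
    have "absv (?s l) * \<rho> ^ (i + j)
        \<le> gauss \<rho> f * (absv (fps_nth g (i + j - l)) * \<rho> ^ (i + j - l))"
      unfolding split[OF l(1)] by (intro mult_right_mono gauss_ge[OF f \<rho>] nn)
    also have "\<dots> < gauss \<rho> f * gauss \<rho> g"
      by (intro mult_strict_left_mono j(2) pos) fact
    finally show ?thesis .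
  qed
  have rest: "absv (\<Sum>l\<in>{0..i+j} - {i}. ?s l) < absv (?s i)"
  proof -
    \<comment> \<open>The inserted 0 keeps the maximum defined when \<open>i + j = 0\<close> leaves
      no other summand, and makes \<open>M\<close> non-negative, as \<open>absv_sum_le\<close>
      demands.\<close>
    define M where "M = Max (insert 0 ((\<lambda>l. absv (?s l)) ` ({0..i+j} - {i})))"
    have lt: "absv (?s l) < absv (?s i)" if "l \<in> {0..i+j} - {i}" for l
    proof -
      have "absv (?s l) * \<rho> ^ (i + j) < absv (?s i) * \<rho> ^ (i + j)"
        using other[of l] that main by auto
      then show ?thesis
        using \<rho> by (simp only: mult_less_cancel_right) auto
    qed
    have "0 < absv (?s i) * \<rho> ^ (i + j)"
      using main pos by simp
    then have "0 < absv (?s i)"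
      using \<rho> by (simp add: zero_less_mult_iff)
    then have "M < absv (?s i)"
      unfolding M_def using lt by (subst Max_less_iff) auto
    moreover have "absv (\<Sum>l\<in>{0..i+j} - {i}. ?s l) \<le> M"
      unfolding M_def by (intro absv_sum_le Max_ge) auto
    ultimately show ?thesis by linarith
  qed
  have "fps_nth (f * g) (i + j) = (\<Sum>l\<in>{0..i+j} - {i}. ?s l) + ?s i"
    unfolding fps_mult_nth by (subst sum.remove[of _ i]) auto
  then have "absv (fps_nth (f * g) (i + j)) * \<rho> ^ (i + j) = gauss \<rho> f * gauss \<rho> g"
    using absv_add_eq[OF rest] main by simp
  then have "gauss \<rho> f * gauss \<rho> g \<le> gauss \<rho> (f * g)"
    using gauss_ge[OF disc_fps_mult[OF f g] \<rho>, of "i + j"] by simp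
  moreover have "gauss \<rho> (f * g) \<le> gauss \<rho> f * gauss \<rho> g"
    using f g \<rho> by (intro gauss_leI mult_coeff_bound gauss_ge)
  ultimately show ?thesis by simp
qed

lemma gauss_power:
  assumes "f \<in> disc_fps r" "0 < \<rho>" "\<rho> < r"
  shows "f ^ n \<in> disc_fps r \<and> gauss \<rho> (f ^ n) = gauss \<rho> f ^ n"
proof (induction n)
  case 0
  then show ?case
    using gauss_const[of \<rho> 1] by simp
next
  case (Suc n)
  then show ?case
    using assms gauss_mult[of f r "f ^ n" \<rho>] by simp
qed

lemma gauss_mono:
  assumes "f \<in> disc_fps r" "0 < \<rho>" "\<rho> \<le> \<rho>'" "\<rho>' < r"
  shows "gauss \<rho> f \<le> gauss \<rho>' f"
proof (rule gauss_leI)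
  fix n
  have "absv (fps_nth f n) * \<rho> ^ n \<le> absv (fps_nth f n) * \<rho>' ^ n"
    using assms absv_nonneg by (intro mult_left_mono power_mono) auto
  also have "\<dots> \<le> gauss \<rho>' f"
    using assms by (intro gauss_ge) auto
  finally show "absv (fps_nth f n) * \<rho> ^ n \<le> gauss \<rho>' f" .
qed

text \<open>Horner's scheme: once \<open>gauss \<rho> f\<close> is large, the product of
  \<open>f\<close> with the value of the shorter polynomial outweighs the constant \<open>a\<close>.
  The threshold depends on \<open>p\<close> alone, so it serves all radii at once.\<close>

lemma gauss_fps_eval:
  "\<exists>M. \<forall>f r \<rho>. f \<in> disc_fps r \<longrightarrow> 0 < \<rho> \<longrightarrow> \<rho> < r \<longrightarrow> M \<le> gauss \<rho> f \<longrightarrow>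
     gauss \<rho> (fps_eval p f) = absv (lead_coeff p) * gauss \<rho> f ^ degree p"
proof (induction p)
  case 0
  then show ?case
    using gauss_const[of _ 0] by simp
next
  case (pCons a p)
  show ?case
  proof (cases "p = 0")
    case True
    then show ?thesis
      using gauss_const by simp
  next
    case False
    then have lc: "0 < absv (lead_coeff p)"
      using absv_nonneg absv_eq_0_iff by (metis leading_coeff_0_iff order_le_less)
    from pCons.IH obtain M where M: "\<And>f r \<rho>. f \<in> disc_fps r \<Longrightarrow> 0 < \<rho> \<Longrightarrow> \<rho> < r \<Longrightarrow> M \<le> gauss \<rho> f \<Longrightarrow>
        gauss \<rho> (fps_eval p f) = absv (lead_coeff p) * gauss \<rho> f ^ degree p"
      by blast
    \<comment> \<open>Above \<open>M\<close> the induction hypothesis holds; above 1 a positive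
      power of the norm is at least the norm; the last bound makes the product strictly larger than
      \<open>a\<close>.\<close>
    define M' where "M' = max (max M 1) (absv a / absv (lead_coeff p) + 1)"
    have "gauss \<rho> (fps_eval (pCons a p) f)
        = absv (lead_coeff (pCons a p)) * gauss \<rho> f ^ degree (pCons a p)"
      if f: "f \<in> disc_fps r" and \<rho>: "0 < \<rho>" "\<rho> < r" and le: "M' \<le> gauss \<rho> f" for f r \<rho>
    proof -
      have ge: "M \<le> gauss \<rho> f" "1 \<le> gauss \<rho> f" "absv a / absv (lead_coeff p) < gauss \<rho> f"
        using le unfolding M'_def by auto
      have eq: "gauss \<rho> (f * fps_eval p f) = absv (lead_coeff p) * gauss \<rho> f ^ Suc (degree p)"
        using gauss_mult[OF f disc_fps_eval[OF f] \<rho>] M[OF f \<rho> ge(1)] by simp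
      have "absv a < absv (lead_coeff p) * gauss \<rho> f"
        using ge(3) lc by (simp add: field_simps)
      also have "\<dots> \<le> absv (lead_coeff p) * gauss \<rho> f ^ Suc (degree p)"
        using lc ge(2) by (intro mult_left_mono) (auto intro: self_le_power simp del: power_Suc)
      finally have "gauss \<rho> (fps_const a) < gauss \<rho> (f * fps_eval p f)"
        using eq by (simp add: gauss_const)
      then have "gauss \<rho> (fps_eval (pCons a p) f) = gauss \<rho> (f * fps_eval p f)"
        using gauss_add_eq[of "fps_const a" r "f * fps_eval p f" \<rho>] f \<rho> by simp
      then show ?thesis
        using eq False by simp
    qed
    then show ?thesis by blast
  qed
qed

section \<open>Behaviour as the radius grows, and unbounded functions\<close>

lemma gauss_lower_bound:
  assumes "h \<in> disc_fps r" "h \<noteq> 0" "0 < \<rho>0" "\<rho>0 < r"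
  obtains c where "0 < c" "\<And>\<rho>. \<rho>0 \<le> \<rho> \<Longrightarrow> \<rho> < r \<Longrightarrow> c \<le> gauss \<rho> h"
  using that[of "gauss \<rho>0 h"] gauss_pos gauss_mono assms by blast

definition gauss_unbounded :: "real \<Rightarrow> 'a fps \<Rightarrow> bool" where
  "gauss_unbounded r f \<longleftrightarrow> f \<in> disc_fps r \<and> (\<forall>M. \<exists>\<rho>. 0 < \<rho> \<and> \<rho> < r \<and> M \<le> gauss \<rho> f)"

lemma gauss_unboundedD:
  assumes "gauss_unbounded r f"
  obtains \<rho>1 where "0 < \<rho>1" "\<rho>1 < r" "\<And>\<rho>. \<rho>1 \<le> \<rho> \<Longrightarrow> \<rho> < r \<Longrightarrow> M \<le> gauss \<rho> f"
proof -
  obtain \<rho>1 where "0 < \<rho>1" "\<rho>1 < r" "M \<le> gauss \<rho>1 f" "f \<in> disc_fps r"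
    using assms unfolding gauss_unbounded_def by blast
  then show ?thesis
    using that[of \<rho>1] gauss_mono by (meson order_trans)
qed

text \<open>The partial sums form a Cauchy sequence, so by completeness the limit that
  \<open>fps_value\<close> describes exists; it is unique, and it inherits the bound
  \<open>C\<close>, which the ultrametric inequality gives for the partial sums.\<close>

lemma fps_value_bound:
  assumes f: "f \<in> disc_fps r" and x: "absv x < r"
    and C: "\<And>n. absv (fps_nth f n * x ^ n) \<le> C"
  shows "absv (fps_value absv f x) \<le> C"
proof -
  let ?s = "\<lambda>n. \<Sum>i<n. fps_nth f i * x ^ i"
  interpret Metric_space UNIV "\<lambda>x y. absv (x - y)"
  proof
    show "absv (x - y) = absv (y - x)" for x y
      using absv_minus[of "x - y"] by simp
    show "absv (x - z) \<le> absv (x - y) + absv (y - z)" for x y z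
      using absv_ultrametric[of "x - y" "y - z"] absv_nonneg[of "x - y"] absv_nonneg[of "y - z"]
      by simp
  qed (auto simp: absv_nonneg absv_eq_0_iff)
  have C0: "0 \<le> C"
    using C[of 0] absv_nonneg by (meson order_trans)
  \<comment> \<open>For non-zero \<open>x\<close>, take a radius strictly between
    \<open>absv x\<close> and \<open>r\<close>: the terms there are bounded, so those at
    \<open>x\<close> decay geometrically.\<close>
  have "(\<lambda>n. absv (fps_nth f n * x ^ n)) \<longlonglongrightarrow> 0"
  proof (cases "x = 0")
    case True
    then have "absv (fps_nth f n * x ^ n) = 0" if "n \<ge> 1" for n
      using that by (simp add: power_0_left)
    then show ?thesis
      by (intro tendsto_eventually) (auto simp: eventually_sequentially)
  next
    case False
    then have x0: "0 < absv x"
      using absv_nonneg[of x] absv_eq_0_iff[of x] by simp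
    obtain \<rho> where \<rho>: "absv x < \<rho>" "\<rho> < r"
      using x dense by blast
    have lim: "(\<lambda>n. gauss \<rho> f * (absv x / \<rho>) ^ n) \<longlonglongrightarrow> gauss \<rho> f * 0"
      using x0 \<rho> by (intro tendsto_mult tendsto_const LIMSEQ_power_zero) simp
    have le: "absv (fps_nth f n * x ^ n) \<le> gauss \<rho> f * (absv x / \<rho>) ^ n" for n
    proof -
      have "absv (fps_nth f n * x ^ n) = absv (fps_nth f n) * \<rho> ^ n * (absv x / \<rho>) ^ n"
        using x0 \<rho> by (simp add: absv_mult absv_power power_divide)
      also have "\<dots> \<le> gauss \<rho> f * (absv x / \<rho>) ^ n"
        using f x0 \<rho> by (intro mult_right_mono gauss_ge) auto
      finally show ?thesis .
    qed
    show ?thesis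
      by (rule tendsto_sandwich[OF _ _ tendsto_const lim[simplified]]) (simp_all add: le absv_nonneg)
  qed
  note terms = this
  have "MCauchy ?s"
    unfolding MCauchy_def
  proof (intro conjI allI impI)
    fix e :: real
    assume e: "0 < e"
    then obtain N where N: "\<And>n. n \<ge> N \<Longrightarrow> absv (fps_nth f n * x ^ n) < e / 2"
      using order_tendstoD(2)[OF terms, of "e / 2"] by (auto simp: eventually_sequentially)
    \<comment> \<open>A block of terms is no larger than its largest member, so null terms suffice
      for a Cauchy sequence.\<close>
    have *: "absv (?s n - ?s m) < e" if "N \<le> m" "m \<le> n" for m n
    proof -
      have "?s n - ?s m = (\<Sum>i\<in>{m..<n}. fps_nth f i * x ^ i)"
        using that by (simp add: sum_diff_nat_ivl[of 0 m n, simplified] lessThan_atLeast0 sum_diff_nat_ivl)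
      moreover have "absv \<dots> \<le> e / 2"
        using N that e by (intro absv_sum_le) (auto intro: less_imp_le)
      ultimately show ?thesis
        using e by simp
    qed
    show "\<exists>N. \<forall>n n'. N \<le> n \<longrightarrow> N \<le> n' \<longrightarrow> absv (?s n - ?s n') < e"
    proof (intro exI[of _ N] allI impI)
      fix n n'
      assume "N \<le> n" "N \<le> n'"
      then show "absv (?s n - ?s n') < e"
        using *[of n n'] *[of n' n] absv_minus[of "?s n - ?s n'"] by (cases "n \<le> n'") auto
    qed
  qed auto
  then obtain y where "limitin mtopology ?s y sequentially"
    using absv_complete unfolding mcomplete_def by blast
  then have y: "(\<lambda>n. absv (?s n - y)) \<longlonglongrightarrow> 0"
    by (simp add: limitin_metric tendsto_iff dist_real_def absv_nonneg)
  have "fps_value absv f x = y"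
    unfolding fps_value_def
  proof (rule the_equality)
    fix z
    assume z: "(\<lambda>n. absv (?s n - z)) \<longlonglongrightarrow> 0"
    have "absv (z - y) \<le> absv (?s n - z) + absv (?s n - y)" for n
      using triangle[of z "?s n" y] commute[of z "?s n"] by simp
    then have "absv (z - y) \<le> 0 + 0"
      by (intro tendsto_lowerbound[OF tendsto_add[OF z y]]) auto
    then show "z = y"
      using absv_nonneg[of "z - y"] absv_eq_0_iff[of "z - y"] by simp
  qed (rule y)
  moreover have "absv y \<le> C + 0"
  proof (rule tendsto_lowerbound[OF tendsto_add[OF tendsto_const y]])
    have "absv y \<le> C + absv (?s n - y)" for n
    proof -
      have "absv (?s n) \<le> C"
        using C C0 by (intro absv_sum_le) auto
      then show ?thesis
        using absv_ultrametric[of "?s n" "- (?s n - y)"] absv_minus[of "?s n - y"]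
          absv_nonneg[of "?s n - y"] C0 by (auto simp: le_max_iff_disj intro: add_increasing2)
    qed
    then show "\<forall>\<^sub>F n in sequentially. absv y \<le> C + absv (?s n - y)"
      by simp
  qed simp
  ultimately show ?thesis by simp
qed

text \<open>A common bound for all Gauss norms would bound every term of the series at every point
  of the disc, hence all values.\<close>

lemma gauss_unbounded_if_unbounded:
  assumes "f \<in> unbounded_analytic_disc absv r" "0 < r"
  shows "gauss_unbounded r f"
proof -
  have f: "f \<in> disc_fps r"
    using assms analytic_disc_subset_disc_fps unfolding unbounded_analytic_disc_def by blast
  have "\<exists>\<rho>. 0 < \<rho> \<and> \<rho> < r \<and> M \<le> gauss \<rho> f" for M
  proof (rule ccontr)
    assume "\<not> ?thesis"
    then have less: "gauss \<rho> f < M" if "0 < \<rho>" "\<rho> < r" for \<rho>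
      using that by force
    have "absv (fps_value absv f x) \<le> M" if x: "absv x < r" for x
    proof (rule fps_value_bound[OF f x])
      fix n
      \<comment> \<open>The midpoint of \<open>absv x\<close> and \<open>r\<close> is a positive
        radius even for \<open>x = 0\<close>.\<close>
      define \<rho> where "\<rho> = (absv x + r) / 2"
      have \<rho>: "0 < \<rho>" "\<rho> < r" "absv x \<le> \<rho>"
        using x assms(2) absv_nonneg[of x] unfolding \<rho>_def by auto
      have "absv (fps_nth f n * x ^ n) = absv (fps_nth f n) * absv x ^ n"
        by (simp add: absv_mult absv_power)
      also have "\<dots> \<le> absv (fps_nth f n) * \<rho> ^ n"
        using \<rho> absv_nonneg by (intro mult_left_mono power_mono)
      also have "\<dots> \<le> gauss \<rho> f"
        using f \<rho> by (intro gauss_ge)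
      also have "\<dots> \<le> M"
        using less[OF \<rho>(1,2)] by simp
      finally show "absv (fps_nth f n * x ^ n) \<le> M" .
    qed
    then have "f \<in> bounded_analytic_disc absv r"
      using assms(1) unfolding bounded_analytic_disc_def unbounded_analytic_disc_def by blast
    then show False
      using assms(1) unfolding unbounded_analytic_disc_def by blast
  qed
  then show ?thesis
    using f unfolding gauss_unbounded_def by blast
qed

text \<open>Unbounded functions are transcendental over the constants: where the norm of
  \<open>f\<close> is large, that of \<open>p(f)\<close> is a product of positive numbers.\<close>

lemma fps_eval_nonzero:
  assumes "gauss_unbounded r f" "p \<noteq> 0"
  shows "fps_eval p f \<noteq> 0"
proof -
  obtain M where M: "\<And>f r \<rho>. f \<in> disc_fps r \<Longrightarrow> 0 < \<rho> \<Longrightarrow> \<rho> < r \<Longrightarrow> M \<le> gauss \<rho> f \<Longrightarrow>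
      gauss \<rho> (fps_eval p f) = absv (lead_coeff p) * gauss \<rho> f ^ degree p"
    using gauss_fps_eval by blast
  obtain \<rho> where \<rho>: "0 < \<rho>" "\<rho> < r" "max M 1 \<le> gauss \<rho> f" "f \<in> disc_fps r"
    using assms(1) unfolding gauss_unbounded_def by blast
  have "gauss \<rho> (fps_eval p f) = absv (lead_coeff p) * gauss \<rho> f ^ degree p"
    using M \<rho> by simp
  moreover have "absv (lead_coeff p) \<noteq> 0" "gauss \<rho> f \<noteq> 0"
    using assms(2) \<rho> absv_eq_0_iff by auto
  ultimately show ?thesis
    using gauss_const[of \<rho> 0] by auto
qed

end


section \<open>Frobenius descent\<close>

lemma power_CHAR_cancel:
  fixes x y :: "'a::idom"
  assumes p: "prime CHAR('a)" and eq: "x ^ CHAR('a) = y ^ CHAR('a)"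
  shows "x = y"
proof -
  have "(x - y) ^ CHAR('a) = 0"
    using domain_morphism.hom_diff[OF domain_morphism_frobenius[OF p], of x y] eq by simp
  then show ?thesis by simp
qed

text \<open>The Frobenius map is injective, so each law for its inverse may be checked after raising
  both sides to the power \<open>CHAR('a)\<close>.\<close>

lemma domain_morphism_inverse_frobenius:
  fixes \<sigma> :: "'a::idom \<Rightarrow> 'a"
  assumes p: "prime CHAR('a)" and \<sigma>: "\<And>x. \<sigma> x ^ CHAR('a) = x"
  shows "domain_morphism \<sigma>"
proof
  show "\<sigma> 1 = 1"
    by (rule power_CHAR_cancel[OF p]) (simp add: \<sigma>)
  show "\<sigma> (x + y) = \<sigma> x + \<sigma> y" for x y
    by (rule power_CHAR_cancel[OF p]) (simp add: \<sigma> freshmans_dream[OF p])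
  show "\<sigma> (x * y) = \<sigma> x * \<sigma> y" for x y
    by (rule power_CHAR_cancel[OF p]) (simp add: \<sigma> power_mult_distrib)
qed

text \<open>The Frobenius map of the power series ring is a morphism taking \<open>h\<close> to its
  power and the coefficients of \<open>map_poly \<sigma> R\<close> to those of
  \<open>R\<close>.\<close>

lemma fps_eval_power_CHAR:
  fixes \<sigma> :: "'a::idom \<Rightarrow> 'a"
  assumes p: "prime CHAR('a)" and \<sigma>: "\<And>x. \<sigma> x ^ CHAR('a) = x"
  shows "fps_eval R (h ^ CHAR('a)) = fps_eval (map_poly \<sigma> R) h ^ CHAR('a)"
proof -
  interpret \<sigma>: domain_morphism \<sigma>
    using p \<sigma> by (rule domain_morphism_inverse_frobenius)
  have F: "domain_morphism (\<lambda>x::'a fps. x ^ CHAR('a))"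
    using domain_morphism_frobenius[where 'a = "'a fps"] p by simp
  have "map_poly (\<lambda>x::'a fps. x ^ CHAR('a)) (map_poly fps_const (map_poly \<sigma> R)) = map_poly fps_const R"
    using prime_gt_0_nat[OF p]
    by (intro poly_eqI) (simp add: coeff_map_poly \<sigma>.hom_zero fps_const_power \<sigma>)
  then show ?thesis
    using domain_morphism.poly_map_poly[OF F, of "map_poly fps_const (map_poly \<sigma> R)" h]
    by (simp add: fps_eval_def)
qed

text \<open>A vanishing derivative leaves only coefficients whose index is a multiple of the
  characteristic; their roots are the coefficients of \<open>h\<close>.\<close>

lemma (in complete_nonarch_field) frobenius_root:
  fixes \<sigma> :: "'a \<Rightarrow> 'a"
  assumes p: "prime CHAR('a)" and \<sigma>: "\<And>x. \<sigma> x ^ CHAR('a) = x"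
    and f: "gauss_unbounded r f" "fps_deriv f = 0"
  obtains h where "gauss_unbounded r h" "f = h ^ CHAR('a)"
proof -
  let ?p = "CHAR('a)"
  have p0: "0 < ?p"
    using p by (rule prime_gt_0_nat)
  have fd: "f \<in> disc_fps r"
    using f(1) unfolding gauss_unbounded_def by simp
  define h where "h = Abs_fps (\<lambda>n. \<sigma> (fps_nth f (?p * n)))"
  have f0: "fps_nth f n = 0" if "\<not> ?p dvd n" for n
  proof -
    have "n \<noteq> 0"
      using that by (metis dvd_0_right)
    then obtain m where m: "n = Suc m"
      using not0_implies_Suc by blast
    have "of_nat n * fps_nth f n = 0"
      using f(2) fps_deriv_nth[of f m] m by simp
    then show ?thesis
      using that of_nat_eq_0_iff_char_dvd[where 'a = 'a, of n] by auto
  qed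
  have fh: "f = h ^ ?p"
    by (rule fps_ext) (simp add: fps_nth_power_CHAR[OF p] f0 h_def \<sigma>)
  have coeff: "(absv (fps_nth h n) * \<rho> ^ n) ^ ?p = absv (fps_nth f (?p * n)) * \<rho> ^ (?p * n)" for n \<rho>
    by (simp add: h_def power_mult_distrib \<sigma> flip: absv_power power_mult) (simp add: mult.commute)
  have hd: "h \<in> disc_fps r"
  proof (rule disc_fpsI)
    fix \<rho> :: real
    assume \<rho>: "0 < \<rho>" "\<rho> < r"
    \<comment> \<open>A number above 1 is at most its power, so the bound for \<open>f\<close>
      serves for \<open>h\<close> without extracting real roots.\<close>
    have "absv (fps_nth h n) * \<rho> ^ n \<le> max 1 (gauss \<rho> f)" (is "?x \<le> _") for n
    proof (cases "?x \<le> 1")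
      case False
      then have "?x \<le> ?x ^ ?p"
        using p0 by (intro self_le_power) auto
      also have "\<dots> \<le> gauss \<rho> f"
        unfolding coeff using fd \<rho> by (rule gauss_ge)
      finally show ?thesis by simp
    qed simp
    then show "\<exists>C. \<forall>n. absv (fps_nth h n) * \<rho> ^ n \<le> C" by blast
  qed
  have "\<exists>\<rho>. 0 < \<rho> \<and> \<rho> < r \<and> M \<le> gauss \<rho> h" for M
  proof -
    \<comment> \<open>Replacing \<open>M\<close> by \<open>max M 0\<close> allows the powers to be
      compared through their non-negative bases.\<close>
    obtain \<rho> where \<rho>: "0 < \<rho>" "\<rho> < r" "max M 0 ^ ?p \<le> gauss \<rho> f"
      using f(1) unfolding gauss_unbounded_def by blast
    have "max M 0 ^ ?p \<le> gauss \<rho> h ^ ?p"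
      using \<rho>(3) gauss_power[OF hd \<rho>(1,2)] fh by metis
    then have "max M 0 \<le> gauss \<rho> h"
      using p0 gauss_nonneg[OF hd \<rho>(1,2)] by (simp only: power_mono_iff)
    with \<rho> show ?thesis by auto
  qed
  then have "gauss_unbounded r h"
    using hd unfolding gauss_unbounded_def by blast
  then show ?thesis
    using fh that by blast
qed

section \<open>The degree inequality\<close>

text \<open>For \<open>m > n\<close>, cancelling \<open>x ^ n\<close> would leave
  \<open>x \<le> C\<close> for arbitrarily large \<open>x\<close>.\<close>

lemma exponent_le_if_power_le:
  fixes C :: real
  assumes "\<And>M. \<exists>x\<ge>M. x ^ m \<le> C * x ^ n"
  shows "m \<le> n"
proof (rule ccontr)
  assume "\<not> m \<le> n"
  obtain x where x: "max 1 (\<bar>C\<bar> + 1) \<le> x" "x ^ m \<le> C * x ^ n"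
    using assms by blast
  have "x * x ^ n \<le> x ^ m"
    using x \<open>\<not> m \<le> n\<close> by (auto simp flip: power_Suc intro: power_increasing)
  also note x(2)
  finally have "x * x ^ n \<le> C * x ^ n" .
  moreover have "0 < x ^ n"
    using x by (intro zero_less_power) simp
  ultimately have "x \<le> C"
    by (rule mult_right_le_imp_le)
  then show False
    using x by linarith
qed

text \<open>
  The conditions at \<open>c\<close> say that \<open>P - \<mu>\<close> vanishes to order at least \<open>2\<close> at \<open>c\<close> and that the
  numerator of \<open>Q - \<mu>\<close> has no multiple zero. They are phrased as identities between polynomials so
  that they survive an automorphism of the coefficient field.
\<close>

definition critical_values_avoided ::
  "'a::field poly \<Rightarrow> 'a poly \<Rightarrow> 'a poly \<Rightarrow> 'a poly \<Rightarrow> 'a set \<Rightarrow> bool" where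
  "critical_values_avoided R S V W C \<longleftrightarrow>
     (\<exists>a b. a * R + b * S = 1) \<and> (\<exists>a b. a * V + b * W = 1) \<and>
     pderiv R * S - R * pderiv S \<noteq> 0 \<and> finite C \<and>
     (\<forall>c\<in>C. \<exists>\<mu> B a b. R - smult \<mu> S = [:- c, 1:]\<^sup>2 * B \<and>
        a * (V - smult \<mu> W) + b * pderiv (V - smult \<mu> W) = 1)"

text \<open>Polynomial identities are carried over by \<open>map_poly \<sigma>\<close>, with \<mu>
  replaced by \<open>\<sigma> \<mu>\<close>; the non-vanishing clause survives because a morphism of
  fields is injective.\<close>

lemma critical_values_avoided_map_poly:
  fixes \<sigma> :: "'a::field \<Rightarrow> 'a"
  assumes \<sigma>: "domain_morphism \<sigma>"
    and crit: "critical_values_avoided R S V W C"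
  shows "critical_values_avoided (map_poly \<sigma> R) (map_poly \<sigma> S) (map_poly \<sigma> V) (map_poly \<sigma> W) (\<sigma> ` C)"
proof -
  interpret domain_morphism \<sigma> by fact
  interpret poly: domain_morphism "map_poly \<sigma>"
    by (rule domain_morphism_map_poly)
  have inj: "\<sigma> x = 0 \<Longrightarrow> x = 0" for x
    using hom_mult[of x "inverse x"] hom_one by (cases "x = 0") auto
  have inj_poly: "map_poly \<sigma> p = 0 \<Longrightarrow> p = 0" for p
    using inj by (auto simp: poly_eq_iff coeff_map_poly hom_zero)
  have bezout: "\<exists>a' b'. a' * map_poly \<sigma> x + b' * map_poly \<sigma> y = 1" if "a * x + b * y = 1" for a b x y
    using arg_cong[OF that, of "map_poly \<sigma>"] by (auto simp: poly.hom_add poly.hom_mult poly.hom_one)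
  have lin: "map_poly \<sigma> [:- c, 1:] = [:- \<sigma> c, 1:]" for c
    by (simp add: map_poly_pCons_hom hom_uminus hom_one)
  have diff: "map_poly \<sigma> (x - smult \<mu> y) = map_poly \<sigma> x - smult (\<sigma> \<mu>) (map_poly \<sigma> y)" for x y \<mu>
    by (simp add: poly.hom_diff map_poly_smult_hom)
  show ?thesis
    unfolding critical_values_avoided_def
  proof (intro conjI ballI)
    show "\<exists>a b. a * map_poly \<sigma> R + b * map_poly \<sigma> S = 1"
      using crit bezout unfolding critical_values_avoided_def by blast
    show "\<exists>a b. a * map_poly \<sigma> V + b * map_poly \<sigma> W = 1"
      using crit bezout unfolding critical_values_avoided_def by blast
    have "map_poly \<sigma> (pderiv R * S - R * pderiv S) \<noteq> 0"
      using crit inj_poly unfolding critical_values_avoided_def by blast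
    then show "pderiv (map_poly \<sigma> R) * map_poly \<sigma> S - map_poly \<sigma> R * pderiv (map_poly \<sigma> S) \<noteq> 0"
      by (simp add: poly.hom_diff poly.hom_mult pderiv_map_poly)
    show "finite (\<sigma> ` C)"
      using crit unfolding critical_values_avoided_def by blast
  next
    fix c'
    assume "c' \<in> \<sigma> ` C"
    then obtain c where c: "c \<in> C" "c' = \<sigma> c" by blast
    then obtain \<mu> B a b where 1: "R - smult \<mu> S = [:- c, 1:]\<^sup>2 * B"
      and 2: "a * (V - smult \<mu> W) + b * pderiv (V - smult \<mu> W) = 1"
      using crit unfolding critical_values_avoided_def by blast
    have "map_poly \<sigma> R - smult (\<sigma> \<mu>) (map_poly \<sigma> S) = [:- c', 1:]\<^sup>2 * map_poly \<sigma> B"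
      using arg_cong[OF 1, of "map_poly \<sigma>"]
      by (simp only: diff poly.hom_mult poly.hom_power lin c(2))
    moreover obtain a' b' where
      "a' * map_poly \<sigma> (V - smult \<mu> W) + b' * map_poly \<sigma> (pderiv (V - smult \<mu> W)) = 1"
      using bezout[OF 2] by blast
    then have "a' * (map_poly \<sigma> V - smult (\<sigma> \<mu>) (map_poly \<sigma> W))
        + b' * pderiv (map_poly \<sigma> V - smult (\<sigma> \<mu>) (map_poly \<sigma> W)) = 1"
      unfolding pderiv_map_poly[symmetric] diff .
    ultimately show "\<exists>\<mu> B a b. map_poly \<sigma> R - smult \<mu> (map_poly \<sigma> S) = [:- c', 1:]\<^sup>2 * B \<and>
        a * (map_poly \<sigma> V - smult \<mu> (map_poly \<sigma> W))
        + b * pderiv (map_poly \<sigma> V - smult \<mu> (map_poly \<sigma> W)) = 1"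
      by blast
  qed
qed

section \<open>Divisibility and growth on the disc\<close>

context complete_nonarch_field
begin

text \<open>The factors are pairwise comaximal. Cofactors are required to lie in
  \<open>disc_fps r\<close>: among formal series \<open>f - c\<close> is a unit whenever its
  constant term is non-zero, and divisibility would say nothing.\<close>

lemma prod_linear_dvd_in_disc:
  assumes f: "f \<in> disc_fps r" and "finite C"
    and "\<And>c. c \<in> C \<Longrightarrow> \<exists>h\<in>disc_fps r. G = (f - fps_const c) * h"
    and G: "G \<in> disc_fps r"
  shows "\<exists>h\<in>disc_fps r. G = fps_eval (\<Prod>c\<in>C. [:- c, 1:]) f * h"
  using assms(2,3)
proof (induction C rule: finite_induct)
  case empty
  then show ?case
    using G by auto
next
  case (insert c C)
  let ?p = "\<Prod>c\<in>C. [:- c, 1:]"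
  obtain h where h: "h \<in> disc_fps r" "G = fps_eval ?p f * h"
    using insert by auto
  obtain h' where h': "h' \<in> disc_fps r" "G = (f - fps_const c) * h'"
    using insert.prems by blast
  \<comment> \<open>Modulo \<open>x - c\<close> the product over \<open>C\<close> is the non-zero
    constant \<open>v\<close>, which makes it comaximal with \<open>x - c\<close>.\<close>
  define v where "v = poly ?p c"
  have v: "v \<noteq> 0"
    unfolding v_def using insert.hyps by (auto simp: poly_prod)
  have "[:- c, 1:] dvd ?p - [:v:]"
    by (simp add: v_def flip: poly_eq_0_iff_dvd)
  then obtain q where "?p - [:v:] = [:- c, 1:] * q" ..
  then have "?p = [:- c, 1:] * q + [:v:]"
    by (simp add: algebra_simps)
  then have "fps_eval ?p f = fps_eval ([:- c, 1:] * q + [:v:]) f"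
    by (rule arg_cong)
  then have p: "fps_eval ?p f = (f - fps_const c) * fps_eval q f + fps_const v"
    by (simp add: fps_eval_linear fps_eval_const del: mult_pCons_left fps_eval_pCons)
  have "G = fps_const (inverse v) * (fps_const v * G)"
    using v by (simp flip: mult.assoc)
  \<comment> \<open>In each of the two terms \<open>G\<close> is then replaced by the factorization
    that supplies the missing factor.\<close>
  also have "fps_const v * G = fps_eval ?p f * G - (f - fps_const c) * fps_eval q f * G"
    unfolding p by (simp add: algebra_simps)
  also have "\<dots> = fps_eval ?p f * ((f - fps_const c) * h')
      - (f - fps_const c) * fps_eval q f * (fps_eval ?p f * h)"
    using h(2) h'(2) by metis
  also have "fps_const (inverse v) * \<dots>
      = fps_eval ([:- c, 1:] * ?p) f * (fps_const (inverse v) * (h' - fps_eval q f * h))"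
    by (simp add: fps_eval_linear algebra_simps del: mult_pCons_left fps_eval_pCons)
  finally have "G = fps_eval ([:- c, 1:] * ?p) f * (fps_const (inverse v) * (h' - fps_eval q f * h))" .
  moreover have "fps_const (inverse v) * (h' - fps_eval q f * h) \<in> disc_fps r"
    using h(1) h'(1) f by simp
  ultimately show ?case
    using insert.hyps by (auto simp del: mult_pCons_left)
qed

text \<open>Coprime representations of one quotient differ by a unit. The unit \<open>w\<close> and
  its inverse \<open>u\<close> arise by applying the Bezout coefficients of each pair to the other
  pair.\<close>

lemma coprime_quotients_unit_factor:
  assumes f: "f \<in> disc_fps r" and g: "g \<in> disc_fps r"
    and RS: "a * R + b * S = 1" and VW: "a' * V + b' * W = 1"
    and eq: "fps_eval R f * fps_eval W g = fps_eval V g * fps_eval S f"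
  obtains u w where "u \<in> disc_fps r" "w \<in> disc_fps r" "u * w = 1"
    "fps_eval V g = fps_eval R f * w" "fps_eval W g = fps_eval S f * w"
proof -
  have 1: "fps_eval a f * fps_eval R f + fps_eval b f * fps_eval S f = 1"
    using arg_cong[OF RS, of "\<lambda>p. fps_eval p f"] by simp
  have 2: "fps_eval a' g * fps_eval V g + fps_eval b' g * fps_eval W g = 1"
    using arg_cong[OF VW, of "\<lambda>p. fps_eval p g"] by simp
  define w where "w = fps_eval a f * fps_eval V g + fps_eval b f * fps_eval W g"
  define u where "u = fps_eval a' g * fps_eval R f + fps_eval b' g * fps_eval S f"
  have V: "fps_eval V g = fps_eval R f * w"
    unfolding w_def using 1 eq by algebra
  have W: "fps_eval W g = fps_eval S f * w"
    unfolding w_def using 1 eq by algebra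
  have "u * w = 1"
    unfolding u_def using 2 V W by algebra
  moreover have "u \<in> disc_fps r" "w \<in> disc_fps r"
    unfolding u_def w_def using f g by auto
  ultimately show ?thesis
    using that V W by blast
qed

lemma linear_dvd_deriv:
  assumes f: "f \<in> disc_fps r" and g: "g \<in> disc_fps r" and w: "w \<in> disc_fps r"
    and V: "fps_eval V g = fps_eval R f * w" and W: "fps_eval W g = fps_eval S f * w"
    and B: "R - smult \<mu> S = [:- c, 1:]\<^sup>2 * B"
    and sqf: "a * (V - smult \<mu> W) + b * pderiv (V - smult \<mu> W) = 1"
  shows "\<exists>h\<in>disc_fps r. fps_deriv g = (f - fps_const c) * h"
  \<comment> \<open>\<open>f - c\<close> divides \<open>L(g)\<close> twice, hence divides \<open>L(g)' = L'(g) g'\<close>; and \<open>L(g)\<close>, \<open>L'(g)\<close> generate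
    the unit ideal.\<close>
proof -
  define L where "L = V - smult \<mu> W"
  define \<phi> where "\<phi> = f - fps_const c"
  define k where "k = fps_eval B f * w"
  have [simp]: "\<phi> \<in> disc_fps r" "k \<in> disc_fps r"
    unfolding \<phi>_def k_def using f w by auto
  have "fps_eval (R - smult \<mu> S) f = fps_eval ([:- c, 1:]\<^sup>2 * B) f"
    using B by simp
  then have "fps_eval R f - fps_const \<mu> * fps_eval S f = \<phi>\<^sup>2 * fps_eval B f"
    by (simp add: \<phi>_def fps_eval_linear del: mult_pCons_left fps_eval_pCons)
  then have L: "fps_eval L g = \<phi>\<^sup>2 * k"
  proof -
    have "fps_eval L g = (fps_eval R f - fps_const \<mu> * fps_eval S f) * w"
      unfolding L_def by (simp add: V W algebra_simps)
    with \<open>_ = \<phi>\<^sup>2 * fps_eval B f\<close> show ?thesis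
      by (simp add: k_def mult.assoc)
  qed
  have "fps_eval (pderiv L) g * fps_deriv g = fps_deriv (\<phi>\<^sup>2 * k)"
    by (simp add: fps_deriv_fps_eval flip: L)
  then have L': "fps_eval (pderiv L) g * fps_deriv g = \<phi> * (2 * fps_deriv \<phi> * k + \<phi> * fps_deriv k)"
    by (simp add: power2_eq_square algebra_simps)
  have "fps_eval a g * fps_eval L g + fps_eval b g * fps_eval (pderiv L) g = 1"
    using arg_cong[OF sqf, of "\<lambda>p. fps_eval p g"] by (simp add: L_def)
  then have "fps_deriv g
      = (fps_eval a g * fps_eval L g + fps_eval b g * fps_eval (pderiv L) g) * fps_deriv g"
    by simp
  also have "\<dots> = fps_eval a g * fps_deriv g * fps_eval L g
      + fps_eval b g * (fps_eval (pderiv L) g * fps_deriv g)"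
    by (simp only: algebra_simps)
  also have "\<dots> = \<phi> * (fps_eval a g * \<phi> * k * fps_deriv g
      + fps_eval b g * (2 * fps_deriv \<phi> * k + \<phi> * fps_deriv k))"
    unfolding L L' by (simp only: algebra_simps power2_eq_square)
  finally have "fps_deriv g = \<phi> * (fps_eval a g * \<phi> * k * fps_deriv g
      + fps_eval b g * (2 * fps_deriv \<phi> * k + \<phi> * fps_deriv k))" .
  moreover have "fps_eval a g * \<phi> * k * fps_deriv g
      + fps_eval b g * (2 * fps_deriv \<phi> * k + \<phi> * fps_deriv k) \<in> disc_fps r"
    using g by simp
  ultimately show ?thesis
    unfolding \<phi>_def[symmetric] by blast
qed

text \<open>With \<open>x\<close>, \<open>y\<close> the Gauss norms of \<open>f\<close>,
  \<open>g\<close> near \<open>r\<close>, the \<open>q\<close>-th power of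
  \<open>x ^ k \<le> const * y\<close> is chained with
  \<open>y ^ q \<le> const * x ^ p\<close>.\<close>

lemma degree_bound_separable:
  assumes f: "gauss_unbounded r f" and g: "gauss_unbounded r g" and g': "fps_deriv g \<noteq> 0"
    and crit: "critical_values_avoided R S V W C"
    and eq: "fps_eval R f * fps_eval W g = fps_eval V g * fps_eval S f"
  shows "card C * max (degree V) (degree W) \<le> max (degree R) (degree S)"
proof -
  have fd: "f \<in> disc_fps r" and gd: "g \<in> disc_fps r"
    using f g unfolding gauss_unbounded_def by auto
  have finC: "finite C"
    using crit unfolding critical_values_avoided_def by blast
  obtain a b a' b' where "a * R + b * S = 1" "a' * V + b' * W = 1"
    using crit unfolding critical_values_avoided_def by blast
  then obtain u w where uw: "u \<in> disc_fps r" "w \<in> disc_fps r" "u * w = 1"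
    "fps_eval V g = fps_eval R f * w" "fps_eval W g = fps_eval S f * w"
    using coprime_quotients_unit_factor[OF fd gd _ _ eq] by blast
  have "\<exists>h\<in>disc_fps r. fps_deriv g = (f - fps_const c) * h" if "c \<in> C" for c
    using that crit linear_dvd_deriv[OF fd gd uw(2,4,5)] unfolding critical_values_avoided_def by blast
  then obtain h where h: "h \<in> disc_fps r" "fps_deriv g = fps_eval (\<Prod>c\<in>C. [:- c, 1:]) f * h"
    using prod_linear_dvd_in_disc[OF fd finC _ disc_fps_deriv[OF gd]] by blast
  define k where "k = card C"
  define p where "p = max (degree R) (degree S)"
  define q where "q = max (degree V) (degree W)"
  define F where "F = (\<Prod>c\<in>C. [:- c, 1:])"
  have F: "lead_coeff F = 1" "degree F = k"
    unfolding F_def lead_coeff_prod k_def by (simp_all add: degree_prod_eq_sum_degree)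
  \<comment> \<open>\<open>X\<close> is whichever of \<open>V\<close>, \<open>W\<close> has the
    larger degree \<open>q\<close>; for its partner \<open>Y\<close> the bound \<open>p\<close> on
    the degree suffices.\<close>
  obtain X Y where XY: "fps_eval X g = fps_eval Y f * w" "degree X = q" "degree Y \<le> p"
      "q = 0 \<or> X \<noteq> 0"
  proof (cases "degree W \<le> degree V")
    case True
    then show ?thesis
      using that[of V R] uw(4) unfolding p_def q_def by (cases "V = 0") auto
  next
    case False
    then show ?thesis
      using that[of W S] uw(5) unfolding p_def q_def by (cases "W = 0") auto
  qed
  obtain M1 where M1: "\<And>\<rho>. 0 < \<rho> \<Longrightarrow> \<rho> < r \<Longrightarrow> M1 \<le> gauss \<rho> g \<Longrightarrow>
      gauss \<rho> (fps_eval X g) = absv (lead_coeff X) * gauss \<rho> g ^ q"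
    using gauss_fps_eval[of X] gd XY(2) by blast
  obtain M2 where M2: "\<And>\<rho>. 0 < \<rho> \<Longrightarrow> \<rho> < r \<Longrightarrow> M2 \<le> gauss \<rho> f \<Longrightarrow>
      gauss \<rho> (fps_eval Y f) = absv (lead_coeff Y) * gauss \<rho> f ^ degree Y"
    using gauss_fps_eval[of Y] fd by blast
  obtain M3 where M3: "\<And>\<rho>. 0 < \<rho> \<Longrightarrow> \<rho> < r \<Longrightarrow> M3 \<le> gauss \<rho> f \<Longrightarrow>
      gauss \<rho> (fps_eval F f) = gauss \<rho> f ^ k"
    using gauss_fps_eval[of F] fd F by auto
  obtain \<rho>0 where \<rho>0: "0 < \<rho>0" "\<rho>0 < r"
    using gauss_unboundedD[OF f] by blast
  have "h \<noteq> 0" "u \<noteq> 0"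
    using g' h uw by auto
  \<comment> \<open>The bound for \<open>h\<close> turns the factorization of the derivative into an
    estimate for \<open>f\<close>; a lower bound for \<open>u\<close> is an upper bound for its
    inverse \<open>w\<close>.\<close>
  then obtain ch cu where ch: "0 < ch" "\<And>\<rho>. \<rho>0 \<le> \<rho> \<Longrightarrow> \<rho> < r \<Longrightarrow> ch \<le> gauss \<rho> h"
    and cu: "0 < cu" "\<And>\<rho>. \<rho>0 \<le> \<rho> \<Longrightarrow> \<rho> < r \<Longrightarrow> cu \<le> gauss \<rho> u"
    using gauss_lower_bound[of _ r \<rho>0] h(1) uw(1) \<rho>0 by metis
  show ?thesis
  proof (cases "q = 0")
    case True
    then show ?thesis unfolding q_def by simp
  next
    case False
    then have lX: "0 < absv (lead_coeff X)"
      using XY(4) absv_nonneg absv_eq_0_iff by (metis leading_coeff_0_iff order_le_less)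
    define D where "D = (1 / (\<rho>0 * ch)) ^ q * (absv (lead_coeff Y) / (absv (lead_coeff X) * cu))"
    have "\<exists>x\<ge>M. x ^ (k * q) \<le> D * x ^ p" for M
    proof -
      obtain \<rho>1 where \<rho>1: "0 < \<rho>1" "\<rho>1 < r"
        "\<And>\<rho>. \<rho>1 \<le> \<rho> \<Longrightarrow> \<rho> < r \<Longrightarrow> max (max M 1) (max M2 M3) \<le> gauss \<rho> f"
        using gauss_unboundedD[OF f] by blast
      obtain \<rho>2 where \<rho>2: "0 < \<rho>2" "\<rho>2 < r" "\<And>\<rho>. \<rho>2 \<le> \<rho> \<Longrightarrow> \<rho> < r \<Longrightarrow> M1 \<le> gauss \<rho> g"
        using gauss_unboundedD[OF g] by blast
      define \<rho> where "\<rho> = max \<rho>0 (max \<rho>1 \<rho>2)"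
      have \<rho>: "0 < \<rho>" "\<rho> < r" "\<rho>0 \<le> \<rho>" "\<rho>1 \<le> \<rho>" "\<rho>2 \<le> \<rho>"
        unfolding \<rho>_def using \<rho>0 \<rho>1 \<rho>2 by auto
      define x where "x = gauss \<rho> f"
      define y where "y = gauss \<rho> g"
      have x: "M \<le> x" "1 \<le> x" "M2 \<le> x" "M3 \<le> x"
        using \<rho>1(3)[OF \<rho>(4,2)] unfolding x_def by auto
      have y: "M1 \<le> y" "0 \<le> y"
        using \<rho>2(3)[OF \<rho>(5,2)] gauss_nonneg[OF gd \<rho>(1,2)] unfolding y_def by auto
      have "x ^ k * ch \<le> x ^ k * gauss \<rho> h"
        using ch(2)[OF \<rho>(3,2)] x by (intro mult_left_mono) auto
      also have "\<dots> = gauss \<rho> (fps_deriv g)"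
        using gauss_mult[of "fps_eval F f" r h \<rho>] M3[OF \<rho>(1,2)] x(4) h fd \<rho>
        unfolding x_def F_def by simp
      also have "\<dots> \<le> y / \<rho>"
        unfolding y_def using gauss_deriv_le[OF gd \<rho>(1,2)] .
      \<comment> \<open>The constant must not depend on \<rho>.\<close>
      also have "\<dots> \<le> y / \<rho>0"
        using y \<rho> \<rho>0 by (intro divide_left_mono) auto
      finally have "x ^ k \<le> 1 / (\<rho>0 * ch) * y"
        using ch(1) \<rho>0 by (simp add: field_simps)
      then have 1: "x ^ (k * q) \<le> (1 / (\<rho>0 * ch)) ^ q * y ^ q"
        unfolding power_mult power_mult_distrib[symmetric] using x by (intro power_mono) auto
      have uw1: "gauss \<rho> u * gauss \<rho> w = 1"
        using gauss_mult[OF uw(1,2) \<rho>(1,2)] uw(3) gauss_const[of \<rho> 1] by simp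
      then have "gauss \<rho> w = 1 / gauss \<rho> u"
        by (metis mult_zero_left nonzero_eq_divide_eq mult.commute zero_neq_one)
      also have "\<dots> \<le> 1 / cu"
        using cu(2)[OF \<rho>(3,2)] cu(1) by (intro divide_left_mono) auto
      finally have w: "gauss \<rho> w \<le> 1 / cu" .
      have "absv (lead_coeff X) * y ^ q = gauss \<rho> (fps_eval Y f * w)"
        using M1[OF \<rho>(1,2)] y(1) XY(1) unfolding y_def by simp
      also have "\<dots> = absv (lead_coeff Y) * x ^ degree Y * gauss \<rho> w"
        using gauss_mult[OF _ uw(2) \<rho>(1,2), of "fps_eval Y f"] fd M2[OF \<rho>(1,2)] x(3)
        unfolding x_def by simp
      also have "\<dots> \<le> absv (lead_coeff Y) * x ^ p * (1 / cu)"
        using w x XY(3) absv_nonneg gauss_nonneg[OF uw(2) \<rho>(1,2)]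
        by (intro mult_mono mult_left_mono power_increasing) auto
      finally have 2: "y ^ q \<le> absv (lead_coeff Y) / (absv (lead_coeff X) * cu) * x ^ p"
        using lX cu(1) by (simp add: field_simps)
      have "x ^ (k * q) \<le> (1 / (\<rho>0 * ch)) ^ q * (absv (lead_coeff Y) / (absv (lead_coeff X) * cu) * x ^ p)"
        using ch(1) \<rho>0 by (intro order_trans[OF 1] mult_left_mono[OF 2]) auto
      then show ?thesis
        using x(1) unfolding D_def by (auto simp: mult.assoc)
    qed
    then show ?thesis
      using exponent_le_if_power_le[of "k * q" D p] unfolding k_def p_def q_def by blast
  qed
qed

text \<open>Differentiating \<open>eq\<close> and eliminating \<open>V(g)\<close> shows that
  \<open>(R' S - R S')(f) * f' * W(g)\<close> vanishes; by transcendence the outer factors are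
  non-zero.\<close>

lemma deriv_eq_0_transfer:
  assumes f: "gauss_unbounded r f" and g: "gauss_unbounded r g" "fps_deriv g = 0"
    and RS: "pderiv R * S - R * pderiv S \<noteq> 0" and W: "W \<noteq> 0"
    and eq: "fps_eval R f * fps_eval W g = fps_eval V g * fps_eval S f"
  shows "fps_deriv f = 0"
proof -
  have "fps_deriv (fps_eval R f * fps_eval W g) = fps_deriv (fps_eval V g * fps_eval S f)"
    using eq by (rule arg_cong)
  then have d: "fps_eval (pderiv R) f * fps_deriv f * fps_eval W g
      = fps_eval V g * (fps_eval (pderiv S) f * fps_deriv f)"
    by (simp add: fps_deriv_fps_eval g(2))
  have "fps_eval (pderiv R * S - R * pderiv S) f * fps_deriv f * fps_eval W g
      = fps_eval S f * (fps_eval (pderiv R) f * fps_deriv f * fps_eval W g)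
        - fps_eval (pderiv S) f * fps_deriv f * (fps_eval R f * fps_eval W g)"
    by (simp add: algebra_simps)
  also have "\<dots> = 0"
    unfolding d eq by (simp add: algebra_simps)
  finally show ?thesis
    using fps_eval_nonzero[OF f RS] fps_eval_nonzero[OF g(1) W] by simp
qed

text \<open>The index \<open>n\<close> witnesses that \<open>g\<close> is not constant and measures
  the descent: passing to a root of \<open>g\<close> divides it by the characteristic, so a non-zero
  derivative is reached eventually.\<close>

lemma degree_bound:
  assumes perfect: "\<And>x::'a. prime CHAR('a) \<Longrightarrow> \<exists>y. y ^ CHAR('a) = x"
    and "gauss_unbounded r f" "gauss_unbounded r g"
    and "critical_values_avoided R S V W C"
    and "W \<noteq> 0"
    and "fps_eval R f * fps_eval W g = fps_eval V g * fps_eval S f"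
    and "0 < n" "fps_nth g n \<noteq> 0"
  shows "card C * max (degree V) (degree W) \<le> max (degree R) (degree S)"
  using assms(2-)
proof (induction n arbitrary: f g R S V W C rule: less_induct)
  case (less n)
  note prems = less.prems
  show ?case
  proof (cases "fps_deriv g = 0")
    case False
    then show ?thesis
      using prems degree_bound_separable by blast
  next
    case True
    let ?p = "CHAR('a)"
    \<comment> \<open>This coefficient forces the characteristic to divide the positive number
      \<open>n\<close>, so the characteristic is a prime.\<close>
    have "fps_nth (fps_deriv g) (n - 1) = of_nat n * fps_nth g n"
      using prems(6) by simp
    then have "of_nat n = (0::'a)"
      using True prems(7) by simp
    then have pn: "?p dvd n"
      by (simp add: of_nat_eq_0_iff_char_dvd)
    then have "0 < ?p"
      using prems(6) by (auto intro: Nat.gr0I)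
    then have p: "prime ?p"
      by (rule prime_CHAR_semidom)
    obtain \<sigma> :: "'a \<Rightarrow> 'a" where \<sigma>: "\<And>x. \<sigma> x ^ ?p = x"
      using perfect[OF p] by metis
    interpret \<sigma>: domain_morphism \<sigma>
      using p \<sigma> by (rule domain_morphism_inverse_frobenius)
    have \<sigma>0: "\<sigma> x = 0 \<Longrightarrow> x = 0" for x
      using \<sigma>[of x] \<open>0 < ?p\<close> by (simp add: power_0_left)
    have inj: "inj \<sigma>"
      using \<sigma> by (metis injI)
    have "fps_deriv f = 0"
      using prems(1,2) True prems(3,4,5) deriv_eq_0_transfer
      unfolding critical_values_avoided_def by blast
    then obtain f1 where f1: "gauss_unbounded r f1" "f = f1 ^ ?p"
      using frobenius_root[OF p \<sigma> prems(1)] by blast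
    obtain g1 where g1: "gauss_unbounded r g1" "g = g1 ^ ?p"
      using frobenius_root[OF p \<sigma> prems(2) True] by blast
    have deg: "degree (map_poly \<sigma> A) = degree A" for A
    proof (cases "A = 0")
      case False
      then have "\<sigma> (lead_coeff A) \<noteq> 0"
        using \<sigma>0 leading_coeff_0_iff by blast
      then show ?thesis
        by (rule map_poly_degree_eq)
    qed simp
    \<comment> \<open>This is the original inequality, as the injective \<sigma> preserves degrees
      and the size of \<open>C\<close>.\<close>
    have "card (\<sigma> ` C) * max (degree (map_poly \<sigma> V)) (degree (map_poly \<sigma> W))
        \<le> max (degree (map_poly \<sigma> R)) (degree (map_poly \<sigma> S))"
    proof (rule less.IH[of "n div ?p" f1 g1])
      show "n div ?p < n"
        using prems(6) prime_gt_1_nat[OF p] by simp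
      show "0 < n div ?p"
        using prems(6) pn \<open>0 < ?p\<close> by (simp add: div_greater_zero_iff dvd_imp_le)
      show "fps_nth g1 (n div ?p) \<noteq> 0"
        using prems(7) pn \<open>0 < ?p\<close> unfolding g1(2) fps_nth_power_CHAR[OF p] by auto
      show "critical_values_avoided (map_poly \<sigma> R) (map_poly \<sigma> S) (map_poly \<sigma> V) (map_poly \<sigma> W) (\<sigma> ` C)"
        using \<sigma>.domain_morphism_axioms prems(3) by (rule critical_values_avoided_map_poly)
      show "map_poly \<sigma> W \<noteq> 0"
        using prems(4) \<sigma>0 by (auto simp: poly_eq_iff coeff_map_poly \<sigma>.hom_zero)
      \<comment> \<open>The equation for the roots is the given one after a Frobenius power, which
        can be cancelled.\<close>
      have "(fps_eval (map_poly \<sigma> R) f1 * fps_eval (map_poly \<sigma> W) g1) ^ CHAR('a fps)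
          = (fps_eval (map_poly \<sigma> V) g1 * fps_eval (map_poly \<sigma> S) f1) ^ CHAR('a fps)"
        using prems(5) unfolding f1(2) g1(2)
        by (simp add: fps_eval_power_CHAR[OF p \<sigma>] power_mult_distrib)
      then show "fps_eval (map_poly \<sigma> R) f1 * fps_eval (map_poly \<sigma> W) g1
          = fps_eval (map_poly \<sigma> V) g1 * fps_eval (map_poly \<sigma> S) f1"
        using power_CHAR_cancel[where 'a = "'a fps"] p by simp
    qed (use f1 g1 in auto)
    then show ?thesis
      using inj by (simp add: deg card_image inj_on_subset)
  qed
qed

end

section \<open>Condition (M)\<close>

lemma ratfun_value_Fract:
  fixes A B :: "'a::field poly"
  assumes "poly B x \<noteq> 0"
  shows "ratfun_value (Fract A B) x = poly A x / poly B x"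
  using assms ratfun_eval_Fract[of id B x A] by simp

text \<open>If \<open>S\<close> vanished at \<open>c\<close>, then \<open>R * B = A * S\<close> with
  \<open>B\<close> non-zero at \<open>c\<close> would make \<open>R\<close> vanish there too,
  against the Bezout identity.\<close>

lemma ratfun_regular_coprime:
  fixes R S :: "'a::field poly"
  assumes "S \<noteq> 0" "coprime R S" "ratfun_regular id (Fract R S) c"
  shows "poly S c \<noteq> 0"
proof
  assume S: "poly S c = 0"
  obtain A B where AB: "Fract R S = Fract A B" "poly B c \<noteq> 0"
    using assms(3) unfolding ratfun_regular_def by auto
  then have "R * B = A * S"
    using assms(1) by (subst (asm) eq_fract) auto
  then have "poly R c = 0"
    using S AB(2) by (metis mult_eq_0_iff poly_mult)
  moreover obtain a b where "a * R + b * S = 1"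
    using euclidean_ring_bezout[OF assms(2)] by blast
  then have "poly (a * R + b * S) c = 1"
    by simp
  ultimately show False
    using S by simp
qed

text \<open>A non-constant common divisor would have a root.\<close>

lemma alg_closed_coprimeI:
  fixes A B :: "'a::alg_closed_field poly"
  assumes "\<And>x. poly A x = 0 \<Longrightarrow> poly B x \<noteq> 0"
  shows "coprime A B"
proof (rule coprimeI)
  fix D
  assume D: "D dvd A" "D dvd B"
  have "poly D x \<noteq> 0" for x
    using assms[of x] D by (metis dvd_0_left_iff dvd_trans poly_eq_0_iff_dvd)
  then have "degree D = 0" "D \<noteq> 0"
    using alg_closed_imp_poly_has_root[of D] by auto
  then show "is_unit D"
    by (simp add: is_unit_iff_degree)
qed

lemma double_root_dvd:
  fixes A :: "'a::field poly"
  assumes "poly A c = 0" "poly (pderiv A) c = 0"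
  shows "[:- c, 1:]\<^sup>2 dvd A"
proof -
  obtain B where B: "A = [:- c, 1:] * B"
    using assms(1) poly_eq_0_iff_dvd by (metis dvdE)
  then have "poly B c = 0"
    using assms(2) by (simp add: pderiv_mult pderiv_pCons del: mult_pCons_left)
  then obtain B' where "B = [:- c, 1:] * B'"
    using poly_eq_0_iff_dvd by (metis dvdE)
  then show ?thesis
    using B unfolding power2_eq_square by (metis dvd_triv_left mult.assoc)
qed

section \<open>Reduction of the estimate to the degree inequality\<close>

theorem theorem2p2p5:
  fixes absv :: "'a::alg_closed_field \<Rightarrow> real"
    and r \<rho>0 :: real
    and P Q :: "'a poly fract"
    and R S V W :: "'a poly"
    and f g :: "'a fps"
    and k p q t :: nat
  assumes "complete_nonarch_field absv"
    and "r > 0"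
    and "condition_M P Q R S V W"
    and "k = card (ratfun_zeros (ratfun_deriv P))"
    and "p = max (degree R) (degree S)"
    and "q = max (degree V) (degree W)"
    and "f \<in> unbounded_analytic_disc absv r"
    and "g \<in> unbounded_analytic_disc absv r"
    and "ratfun_eval fls_const P (fps_to_fls f) = ratfun_eval fls_const Q (fps_to_fls g)"
    and "t = ramification_index absv r (fps_to_fls f)"
    and "fps_nth f 0 \<noteq> 0"
    and "0 < \<rho>0" and "\<rho>0 < r"
  shows "(\<exists>E :: real \<Rightarrow> real. bounded (E ` {\<rho>0..<r}) \<and>
           (\<forall>\<rho>\<in>{\<rho>0..<r}.
              0 \<ge> (real k * real q - real p) / (real (char_exponent TYPE('a) ^ t) * real q)
                    * nev_T absv r \<rho> (fps_to_fls f) + E \<rho>)) \<and>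
         int q * int k - int p \<le> 0"
proof -
  interpret complete_nonarch_field absv by fact
  define C where "C = ratfun_zeros (ratfun_deriv P)"
  have P: "P = Fract R S" "S \<noteq> 0" "coprime R S" and Q: "Q = Fract V W" "W \<noteq> 0" "coprime V W"
    and P': "ratfun_deriv P \<noteq> 0" and cardC: "card C > 0"
    and reg: "\<And>c. c \<in> C \<Longrightarrow> ratfun_regular id P c"
    and M3: "\<And>c d. c \<in> C \<Longrightarrow> poly (pderiv V - smult (ratfun_value P c) (pderiv W)) d = 0 \<Longrightarrow>
      poly W d \<noteq> 0 \<and> ratfun_value Q d \<noteq> ratfun_value P c"
    using assms(3) unfolding condition_M_def C_def by auto
  have dP: "ratfun_deriv P = Fract (pderiv R * S - R * pderiv S) (S\<^sup>2)"
    unfolding P(1) using P(2) by (rule ratfun_deriv_Fract)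
  have "\<exists>\<mu> B a b. R - smult \<mu> S = [:- c, 1:]\<^sup>2 * B \<and>
      a * (V - smult \<mu> W) + b * pderiv (V - smult \<mu> W) = 1" if c: "c \<in> C" for c
  proof -
    define \<mu> where "\<mu> = ratfun_value P c"
    have S: "poly S c \<noteq> 0"
      using ratfun_regular_coprime[OF P(2,3)] reg[OF c] P(1) by blast
    then have \<mu>: "\<mu> = poly R c / poly S c"
      unfolding \<mu>_def P(1) by (rule ratfun_value_Fract)
    have "ratfun_value (ratfun_deriv P) c = 0"
      using c unfolding C_def ratfun_zeros_def by blast
    then have "poly (pderiv R * S - R * pderiv S) c = 0"
      unfolding dP using S by (subst (asm) ratfun_value_Fract) auto
    \<comment> \<open>At \<open>c\<close> one has \<open>R' S = R S'\<close>; dividing by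
      \<open>S(c)\<close> gives \<open>R' = \<mu> S'\<close> there.\<close>
    then have "poly (pderiv (R - smult \<mu> S)) c = 0"
      using S unfolding \<mu> by (simp add: pderiv_diff pderiv_smult field_simps)
    moreover have "poly (R - smult \<mu> S) c = 0"
      using S unfolding \<mu> by simp
    ultimately obtain B where B: "R - smult \<mu> S = [:- c, 1:]\<^sup>2 * B"
      using double_root_dvd by (metis dvdE)
    \<comment> \<open>A common zero \<open>d\<close> is excluded by (M): it is a zero of
      \<open>V' - \<mu> W'\<close>, so \<open>W(d)\<close> is non-zero, and then
      \<open>V(d) = \<mu> W(d)\<close> means \<open>Q(d) = \<mu>\<close>.\<close>
    have "coprime (V - smult \<mu> W) (pderiv (V - smult \<mu> W))"
    proof (rule alg_closed_coprimeI, rule notI)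
      fix d
      assume d: "poly (V - smult \<mu> W) d = 0" "poly (pderiv (V - smult \<mu> W)) d = 0"
      then have "poly W d \<noteq> 0" "ratfun_value Q d \<noteq> \<mu>"
        using M3[OF c, of d] unfolding \<mu>_def by (auto simp: pderiv_diff pderiv_smult)
      then show False
        using d(1) ratfun_value_Fract[of W d V] unfolding Q(1) by (simp add: field_simps)
    qed
    then obtain a b where "a * (V - smult \<mu> W) + b * pderiv (V - smult \<mu> W) = 1"
      using euclidean_ring_bezout by blast
    with B show ?thesis by blast
  qed
  moreover have "pderiv R * S - R * pderiv S \<noteq> 0"
    using P' unfolding dP by (metis fract_collapse(1))
  moreover have "finite C"
    using cardC by (metis card.infinite less_numeral_extra(3))
  ultimately have crit: "critical_values_avoided R S V W C"
    unfolding critical_values_avoided_def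
    using euclidean_ring_bezout[OF P(3)] euclidean_ring_bezout[OF Q(3)] by blast
  have f: "gauss_unbounded r f" and g: "gauss_unbounded r g"
    using assms(2,7,8) gauss_unbounded_if_unbounded by blast+
  \<comment> \<open>Transcendence of an unbounded function makes every denominator non-zero.\<close>
  have eval: "ratfun_eval fls_const (Fract A B) (fps_to_fls h)
      = fps_to_fls (fps_eval A h) / fps_to_fls (fps_eval B h)"
    if "gauss_unbounded r h" "B \<noteq> 0" for A B h
    using fps_eval_nonzero[OF that]
    by (subst ratfun_eval_Fract) (simp_all add: poly_map_fls_const_fps_to_fls fls_plus_const)
  have "fps_to_fls (fps_eval R f) * fps_to_fls (fps_eval W g)
      = fps_to_fls (fps_eval V g) * fps_to_fls (fps_eval S f)"
    using assms(9) fps_eval_nonzero[OF f P(2)] fps_eval_nonzero[OF g Q(2)]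
    unfolding P(1) Q(1) eval[OF f P(2)] eval[OF g Q(2)] by (simp add: frac_eq_eq)
  then have eq: "fps_eval R f * fps_eval W g = fps_eval V g * fps_eval S f"
    by (simp flip: fls_times_fps_to_fls)
  \<comment> \<open>A constant \<open>g\<close> would be a zero of a linear polynomial.\<close>
  have "\<exists>n>0. fps_nth g n \<noteq> 0"
  proof (rule ccontr)
    assume "\<not> ?thesis"
    then have "fps_nth g n = 0" if "0 < n" for n
      using that by blast
    then have "fps_nth g n = fps_nth (fps_const (fps_nth g 0)) n" for n
      by (cases "n = 0") simp_all
    then have "g = fps_const (fps_nth g 0)"
      by (rule fps_ext)
    then have "fps_eval [:- fps_nth g 0, 1:] g = 0"
      unfolding fps_eval_linear by (metis diff_self)
    then show False
      using fps_eval_nonzero[OF g, of "[:- fps_nth g 0, 1:]"] by simp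
  qed
  then obtain n where n: "0 < n" "fps_nth g n \<noteq> 0" by blast
  have root: "\<exists>y. y ^ CHAR('a) = x" if "prime CHAR('a)" for x :: 'a
    using nth_root_exists[of "CHAR('a)" x] prime_gt_0_nat[OF that] by blast
  have "card C * q \<le> p"
    unfolding assms(5,6) by (rule degree_bound[OF root f g crit Q(2) eq n])
  then have kq: "k * q \<le> p"
    unfolding assms(4) C_def .
  have "0 \<le> nev_Z absv r \<rho> h" if "0 < \<rho>" for \<rho> h
    unfolding nev_Z_def
  proof (rule sum_nonneg)
    fix \<alpha>
    assume "\<alpha> \<in> {\<alpha>. 0 < order_at absv r h \<alpha> \<and> absv \<alpha> \<le> \<rho>}"
    \<comment> \<open>For \<alpha> = 0 the summand is 0, by the conventions
      \<open>\<rho> / 0 = 0\<close> and \<open>ln 0 = 0\<close>; otherwise the logarithm is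
      non-negative.\<close>
    then have "0 < order_at absv r h \<alpha>" "absv \<alpha> = 0 \<or> 1 \<le> \<rho> / absv \<alpha>"
      using absv_nonneg[of \<alpha>] by (auto simp: le_divide_eq_1 less_le)
    then show "0 \<le> real_of_int (order_at absv r h \<alpha>) * ln (\<rho> / absv \<alpha>)"
      by (elim disjE) (simp_all add: mult_nonneg_nonneg)
  qed
  then have T: "0 \<le> nev_T absv r \<rho> (fps_to_fls f)" if "\<rho> \<in> {\<rho>0..<r}" for \<rho>
    using that assms(12) unfolding nev_T_def by (simp add: le_max_iff_disj)
  have "real k * real q \<le> real p"
    using kq by (metis of_nat_le_iff of_nat_mult)
  then have "(real k * real q - real p) / (real (char_exponent TYPE('a) ^ t) * real q) \<le> 0"
    by (intro divide_nonpos_nonneg) auto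
  then have "\<forall>\<rho>\<in>{\<rho>0..<r}. 0 \<ge> (real k * real q - real p) / (real (char_exponent TYPE('a) ^ t) * real q)
      * nev_T absv r \<rho> (fps_to_fls f) + 0"
    using T by (simp only: add_0_right) (blast intro: mult_nonpos_nonneg)
  moreover have "bounded ((\<lambda>_. 0 :: real) ` {\<rho>0..<r})"
    by (rule finite_imp_bounded) (auto intro: finite_subset[of _ "{0}"])
  ultimately have "\<exists>E :: real \<Rightarrow> real. bounded (E ` {\<rho>0..<r}) \<and>
           (\<forall>\<rho>\<in>{\<rho>0..<r}.
              0 \<ge> (real k * real q - real p) / (real (char_exponent TYPE('a) ^ t) * real q)
                    * nev_T absv r \<rho> (fps_to_fls f) + E \<rho>)"
    by (intro exI[of _ "\<lambda>_. 0"]) blast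
  moreover have "int q * int k - int p \<le> 0"
    using kq by (metis diff_le_0_iff_le mult.commute of_nat_le_iff of_nat_mult)
  ultimately show ?thesis by blast
qed

end
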